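(* Let $n\ge1$ and $\mu=(\mu_1,\ldots,\mu_n)\in[-1/2,\infty)^n$. Let $f\in\mathcal{H}'_\mu$ satisfy $(f,\phi)=0$ for every $\phi\in\mathcal{H}_\mu$ for which $\operatorname{supp}(\phi)\subset\{x\in(0,\infty)^n:\|x\|\ge a\}$ for some $a\in\mathbb{R}$, $a>0$. Then there exist $N\in\mathbb{N}_0$ and scalars $c_k$, $|k|\le N$, such that $$f=\sum_{|k|\le N}c_k\,T^k\delta_\mu .$$
   Context: Multi-indices are elements $k=(k_1,\ldots,k_n)\in\mathbb{N}_0^n$, with $|k|=k_1+\cdots+k_n$; $\|x\|=(x_1^2+\cdots+x_n^2)^{1/2}$; $x^{m}=x_1^{m_1}\cdots x_n^{m_n}$; $-\mu-1/2=(-\mu_1-1/2,\ldots,-\mu_n-1/2)$. Let $T_i=x_i^{-1}\frac{\partial}{\partial x_i}$ and $T^k=T_n^{k_n}\circ\cdots\circ T_1^{k_1}$. The space $\mathcal{H}_\mu$ consists of all (complex-valued) $\phi\in C^\infty((0,\infty)^n)$ such that for all $m\in\mathbb{N}_0$, $k\in\mathbb{N}_0^n$, $$\gamma^\mu_{m,k}(\phi)=\sup_{x\in(0,\infty)^n}\left|(1+\|x\|^2)^m\,T^k\{x^{-\mu-1/2}\phi(x)\}\right|<\infty,$$ and it is a Fréchet space with the topology generated by the seminorms $\gamma^\mu_{m,k}$. $\mathcal{H}'_\mu$ is its dual (continuous linear functionals), with pairing $(f,\phi)$. For a multi-index $k$, the functional $T^k\delta_\mu\in\mathcal{H}'_\mu$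 is defined by $$(T^k\delta_\mu,\phi)=C_\mu\lim_{x\to0,\;x_i>0}T^k\{x^{-\mu-1/2}\phi(x)\},\qquad C_\mu=\prod_{i=1}^n2^{\mu_i}\Gamma(\mu_i+1)$$ (the limit exists for every $\phi\in\mathcal{H}_\mu$). *)

theory Defs
  imports "HOL-Analysis.Analysis"
begin

text \<open>
  The coordinates are indexed by a finite linearly ordered type \<open>'n\<close>, so that \<open>n = CARD('n) \<ge> 1\<close>
  is arbitrary and the factors of \<open>T\<^sup>k\<close> have a definite order.
\<close>

definition orthant :: "(real ^ 'n) set" where
  "orthant = {x. \<forall>i. 0 < x $ i}"

definition mi_abs :: "nat ^ 'n \<Rightarrow> nat" where
  "mi_abs k = (\<Sum>i\<in>UNIV. k $ i)"

lemma finite_mi_abs_le: "finite {k :: nat ^ 'n. mi_abs k \<le> N}"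
proof (rule finite_subset)
  show "{k :: nat ^ 'n. mi_abs k \<le> N} \<subseteq> vec_lambda ` (UNIV \<rightarrow>\<^sub>E {..N})"
  proof
    fix k :: "nat ^ 'n"
    assume "k \<in> {k. mi_abs k \<le> N}"
    then have "k $ i \<le> N" for i
      using member_le_sum[of i UNIV "\<lambda>i. k $ i"] by (simp add: mi_abs_def)
    then have "(\<lambda>i. k $ i) \<in> UNIV \<rightarrow>\<^sub>E {..N}" by auto
    then show "k \<in> vec_lambda ` (UNIV \<rightarrow>\<^sub>E {..N})"
      by (metis image_eqI vec_nth_inverse)
  qed
qed (simp add: finite_PiE)

definition mpow :: "real ^ 'n \<Rightarrow> real ^ 'n \<Rightarrow> real" where
  "mpow x a = (\<Prod>i\<in>UNIV. (x $ i) powr (a $ i))"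

definition partial :: "'n \<Rightarrow> (real ^ 'n \<Rightarrow> complex) \<Rightarrow> real ^ 'n \<Rightarrow> complex" where
  "partial i g x = vector_derivative (\<lambda>t. g (x + t *\<^sub>R axis i 1)) (at 0)"

text \<open>For open \<open>S\<close> the following is membership in \<open>C\<^sup>m(S)\<close>, with \<open>m\<close> the first argument.\<close>

primrec Ck_on :: "nat \<Rightarrow> ('a::real_normed_vector) set \<Rightarrow> ('a \<Rightarrow> 'b::real_normed_vector) \<Rightarrow> bool" where
  "Ck_on 0 S g \<longleftrightarrow> continuous_on S g"
| "Ck_on (Suc m) S g \<longleftrightarrow>
     (\<forall>x\<in>S. g differentiable (at x)) \<and> (\<forall>v. Ck_on m S (\<lambda>x. frechet_derivative g (at x) v))"

definition smooth_on :: "('a::real_normed_vector) set \<Rightarrow> ('a \<Rightarrow> 'b::real_normed_vector) \<Rightarrow> bool" where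
  "smooth_on S g \<longleftrightarrow> (\<forall>m. Ck_on m S g)"

definition T :: "'n \<Rightarrow> (real ^ 'n \<Rightarrow> complex) \<Rightarrow> real ^ 'n \<Rightarrow> complex" where
  "T i g x = inverse (x $ i) *\<^sub>R partial i g x"

text \<open>\<open>fold\<close> applies the operator of the smallest index first.\<close>

definition Tpow ::
  "nat ^ 'n::{finite,linorder} \<Rightarrow> (real ^ 'n::{finite,linorder} \<Rightarrow> complex) \<Rightarrow> real ^ 'n::{finite,linorder} \<Rightarrow> complex" where
  "Tpow k g = fold (\<lambda>i. T i ^^ (k $ i)) (sorted_list_of_set UNIV) g"

definition weighted :: "real ^ 'n \<Rightarrow> (real ^ 'n \<Rightarrow> complex) \<Rightarrow> real ^ 'n \<Rightarrow> complex" where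
  "weighted \<mu> \<phi> x = mpow x (\<chi> i. - \<mu> $ i - 1/2) *\<^sub>R \<phi> x"

definition gamma_fun ::
  "real ^ 'n::{finite,linorder} \<Rightarrow> nat \<Rightarrow> nat ^ 'n::{finite,linorder} \<Rightarrow> (real ^ 'n::{finite,linorder} \<Rightarrow> complex) \<Rightarrow> real ^ 'n::{finite,linorder} \<Rightarrow> real" where
  "gamma_fun \<mu> m k \<phi> x = norm ((1 + (norm x)\<^sup>2) ^ m *\<^sub>R Tpow k (weighted \<mu> \<phi>) x)"

definition gamma_seminorm ::
  "real ^ 'n::{finite,linorder} \<Rightarrow> nat \<Rightarrow> nat ^ 'n::{finite,linorder} \<Rightarrow> (real ^ 'n::{finite,linorder} \<Rightarrow> complex) \<Rightarrow> real" where
  "gamma_seminorm \<mu> m k \<phi> = (SUP x\<in>orthant. gamma_fun \<mu> m k \<phi> x)"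

text \<open>
  A function on \<open>orthant\<close> is represented by its extension by 0 to the whole space. Finiteness of
  the supremum is stated as \<open>bdd_above\<close>, since the real-valued \<open>SUP\<close> is only meaningful then.
\<close>

definition H_space :: "real ^ 'n::{finite,linorder} \<Rightarrow> (real ^ 'n::{finite,linorder} \<Rightarrow> complex) set" where
  "H_space \<mu> = {\<phi>. smooth_on orthant \<phi> \<and> (\<forall>x. x \<notin> orthant \<longrightarrow> \<phi> x = 0) \<and>
                  (\<forall>m k. bdd_above (gamma_fun \<mu> m k \<phi> ` orthant))}"

definition H_topology :: "real ^ 'n::{finite,linorder} \<Rightarrow> (real ^ 'n::{finite,linorder} \<Rightarrow> complex) topology" where
  "H_topology \<mu> = topology_generated_by
     {{\<psi> \<in> H_space \<mu>. gamma_seminorm \<mu> m k (\<lambda>x. \<psi> x - \<phi> x) < r} | \<phi> m k r. \<phi> \<in> H_space \<mu> \<and> 0 < r}"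

text \<open>
  Functionals are total on the function type; only their values on \<open>H_space \<mu>\<close> are relevant.
\<close>

definition H_dual :: "real ^ 'n::{finite,linorder} \<Rightarrow> ((real ^ 'n::{finite,linorder} \<Rightarrow> complex) \<Rightarrow> complex) set" where
  "H_dual \<mu> = {f.
     (\<forall>\<phi>\<in>H_space \<mu>. \<forall>\<psi>\<in>H_space \<mu>. f (\<lambda>x. \<phi> x + \<psi> x) = f \<phi> + f \<psi>) \<and>
     (\<forall>c. \<forall>\<phi>\<in>H_space \<mu>. f (\<lambda>x. c * \<phi> x) = c * f \<phi>) \<and>
     continuous_map (H_topology \<mu>) euclidean f}"

definition C_const :: "real ^ 'n \<Rightarrow> real" where
  "C_const \<mu> = (\<Prod>i\<in>UNIV. 2 powr (\<mu> $ i) * Gamma (\<mu> $ i + 1))"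

definition T_delta ::
  "real ^ 'n::{finite,linorder} \<Rightarrow> nat ^ 'n::{finite,linorder} \<Rightarrow> (real ^ 'n::{finite,linorder} \<Rightarrow> complex) \<Rightarrow> complex" where
  "T_delta \<mu> k \<phi> = C_const \<mu> *\<^sub>R Lim (at 0 within orthant) (Tpow k (weighted \<mu> \<phi>))"

text \<open>The support is taken relative to \<open>orthant\<close>, the domain of the functions.\<close>

definition supp :: "(real ^ 'n \<Rightarrow> complex) \<Rightarrow> (real ^ 'n) set" where
  "supp \<phi> = orthant \<inter> closure {x \<in> orthant. \<phi> x \<noteq> 0}"

end

theory Submission
  imports Defs
begin

text \<open>
  Put \<open>u = weighted \<mu> \<phi>\<close>. In the variables \<open>s\<^sub>i = x\<^sub>i\<^sup>2 / 2\<close> the operators \<open>T\<^sub>i\<close> are ordinary partial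
  derivatives. By continuity \<open>f\<close> is controlled by finitely many seminorms, involving derivatives of
  order at most \<open>N\<close>. If all \<open>T\<^sup>k u\<close> with \<open>|k| \<le> N\<close> tend to 0 at the origin, then Taylor's formula in \<open>s\<close>
  gives \<open>T\<^sup>k u = O(\<sigma>^(N + 1 - |k|))\<close> with \<open>\<sigma> = \<parallel>x\<parallel>\<^sup>2\<close>, and these seminorms of \<open>\<chi>(\<sigma>/d) \<phi>\<close>, where \<open>\<chi>\<close> is a smooth
  cutoff, are \<open>O(d)\<close>. The rest of \<open>\<phi>\<close> is supported away from 0, so \<open>f \<phi> = f (\<chi>(\<sigma>/d) \<phi>) \<rightarrow> 0\<close> as \<open>d \<rightarrow> 0\<close>. Hence
  \<open>f\<close> vanishes on the common kernel of the finitely many functionals \<open>T\<^sup>k\<delta>\<^sub>\<mu>\<close>, \<open>|k| \<le> N\<close>, and is therefore a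
  linear combination of them.
\<close>

section \<open>Smooth functions\<close>

text \<open>The change of variables is never carried out: all estimates stay in \<open>x\<close>,
  and the new variables show only in increments being measured by squared norms. Nor is a Taylor
  polynomial formed. As the limits at the origin vanish, the bound at order \<open>N + 1\<close> is
  carried down one order at a time along rays, with the same constant. The cutoff is a function of
  \<open>||x||^2\<close> because \<open>T i\<close> then merely differentiates the outer function
  and multiplies by \<open>2/d\<close>: the factor \<open>x_i\<close> from the chain rule cancels
  the singular \<open>1/x_i\<close>. Iterated operators are indexed by words instead of
  multi-indices. The Leibniz rule then becomes a two-way split without binomial coefficients, and
  the commutation of the \<open>T i\<close>, which rests on the symmetry of second derivatives, is
  needed just for translating words to \<open>Tpow\<close>. Continuity of \<open>f\<close> controls
  orders up to \<open>N\<close>, but the estimate uses order \<open>N + 1\<close>. That bound is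
  finite for each element of \<open>H_space\<close> without being controlled by \<open>f\<close>, so
  the constants depend on \<phi> but not on \<open>d\<close>, and the limit \<open>d -> 0\<close> is
  taken for one \<phi> at a time.\<close>

lemma Ck_on_cong:
  assumes "open S" "\<And>x. x \<in> S \<Longrightarrow> f x = g x" "Ck_on m S f"
  shows "Ck_on m S g"
  using assms(2,3)
proof (induction m arbitrary: f g)
  case 0
  then show ?case by (simp cong: continuous_on_cong)
next
  case (Suc m)
  have "g differentiable at x" if "x \<in> S" for x
    using Suc.prems that assms(1) unfolding differentiable_def
    by (metis Ck_on.simps(2) differentiable_def has_derivative_transform_within_open)
  moreover have "frechet_derivative f (at x) = frechet_derivative g (at x)" if "x \<in> S" for x
    using Suc.prems assms(1) that
    by (metis Ck_on.simps(2) frechet_derivative_transform_within_open)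
  ultimately show ?case
    using Suc.prems(2) Suc.IH[of "\<lambda>x. frechet_derivative f (at x) v" "\<lambda>x. frechet_derivative g (at x) v" for v]
    by simp
qed

lemma Ck_on_SucI:
  assumes "open S" "\<And>x. x \<in> S \<Longrightarrow> (g has_derivative g' x) (at x)" "\<And>v. Ck_on m S (\<lambda>x. g' x v)"
  shows "Ck_on (Suc m) S g"
proof -
  have "frechet_derivative g (at x) = g' x" if "x \<in> S" for x
    using assms(2)[OF that] by (metis frechet_derivative_at)
  then have "Ck_on m S (\<lambda>x. frechet_derivative g (at x) v)" for v
    using assms(3)[of v] by (auto intro: Ck_on_cong[OF assms(1), rotated])
  then show ?thesis
    using assms(2) by (auto simp: differentiable_def)
qed

lemma Ck_on_SucD:
  assumes "Ck_on (Suc m) S g" shows "Ck_on m S g"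
  using assms
proof (induction m arbitrary: g)
  case 0
  then show ?case
    by (auto intro!: continuous_at_imp_continuous_on differentiable_imp_continuous_within)
next
  case (Suc m)
  then show ?case by (metis Ck_on.simps(2))
qed

lemma Ck_on_has_derivative:
  assumes "Ck_on (Suc m) S g" "x \<in> S"
  shows "(g has_derivative frechet_derivative g (at x)) (at x)"
  using assms by (simp add: frechet_derivative_works)

lemma Ck_on_const: "open S \<Longrightarrow> Ck_on m S (\<lambda>x. c)"
  by (induction m arbitrary: c) (auto simp: frechet_derivative_const)

lemma Ck_on_linear:
  assumes "open S" "bounded_linear L"
  shows "Ck_on m S L"
proof (cases m)
  case 0
  then show ?thesis using assms by (simp add: linear_continuous_on)
next
  case (Suc m')
  then show ?thesis
    using assms Ck_on_SucI[of S L "\<lambda>x. L" m'] Ck_on_const[OF assms(1)]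
      bounded_linear_imp_has_derivative[OF assms(2)] by auto
qed

lemma Ck_on_add:
  assumes "open S" "Ck_on m S f" "Ck_on m S g"
  shows "Ck_on m S (\<lambda>x. f x + g x)"
  using assms(2,3)
proof (induction m arbitrary: f g)
  case 0
  then show ?case by (simp add: continuous_on_add)
next
  case (Suc m)
  show ?case
  proof (rule Ck_on_SucI[OF assms(1)])
    fix x assume "x \<in> S"
    then show "((\<lambda>x. f x + g x) has_derivative
      (\<lambda>v. frechet_derivative f (at x) v + frechet_derivative g (at x) v)) (at x)"
      using Suc.prems by (intro has_derivative_add Ck_on_has_derivative)
  qed (use Suc in auto)
qed

text \<open>By the product rule each term of the derivative differentiates one factor and leaves the
  other, which is used at the lower order \<open>m\<close>; so the induction must generalise over
  both factors. One proof serves both \<open>*\<close> and \<open>scaleR\<close>.\<close>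

lemma (in bounded_bilinear) Ck_on:
  assumes "open S" "Ck_on m S f" "Ck_on m S g"
  shows "Ck_on m S (\<lambda>x. prod (f x) (g x))"
  using assms(2,3)
proof (induction m arbitrary: f g)
  case 0
  then show ?case by (simp add: continuous_on)
next
  case (Suc m)
  show ?case
  proof (rule Ck_on_SucI[OF assms(1)])
    fix x assume "x \<in> S"
    then show "((\<lambda>x. prod (f x) (g x)) has_derivative
      (\<lambda>v. prod (f x) (frechet_derivative g (at x) v) + prod (frechet_derivative f (at x) v) (g x))) (at x)"
      using Suc.prems by (intro FDERIV Ck_on_has_derivative)
  next
    show "Ck_on m S (\<lambda>x. prod (f x) (frechet_derivative g (at x) v) + prod (frechet_derivative f (at x) v) (g x))" for v
      using Suc.prems Ck_on_SucD[of m S f] Ck_on_SucD[of m S g]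
      by (intro Ck_on_add Suc.IH assms) auto
  qed
qed

text \<open>The outer function comes with its whole sequence of derivatives
  \<open>h 0, h 1, ...\<close>. The chain rule replaces \<open>h n\<close> by
  \<open>h (Suc n)\<close>, so an induction with \<open>n\<close> arbitrary closes without any
  theory of compositions of smooth maps.\<close>

lemma Ck_on_compose_real:
  fixes h :: "nat \<Rightarrow> real \<Rightarrow> real"
  assumes "open S" "\<And>n t. t \<in> J \<Longrightarrow> (h n has_real_derivative h (Suc n) t) (at t)"
    "p ` S \<subseteq> J" "Ck_on m S p"
  shows "Ck_on m S (\<lambda>x. h n (p x))"
  using assms(4)
proof (induction m arbitrary: n)
  case 0
  have "continuous_on J (h n)"
    using assms(2) by (meson DERIV_isCont continuous_at_imp_continuous_on)
  then show ?case
    using 0 assms(3) by (auto intro: continuous_on_compose2)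
next
  case (Suc m)
  show ?case
  proof (rule Ck_on_SucI[OF assms(1)])
    fix x assume x: "x \<in> S"
    have "(p has_derivative frechet_derivative p (at x)) (at x)"
      using Suc.prems x by (rule Ck_on_has_derivative)
    from has_derivative_compose[OF this, of "h n" "(*) (h (Suc n) (p x))"]
    show "((\<lambda>x. h n (p x)) has_derivative
      (\<lambda>v. h (Suc n) (p x) * frechet_derivative p (at x) v)) (at x)"
      using assms(2)[of "p x" n] assms(3) x by (auto simp: has_field_derivative_def)
  next
    show "Ck_on m S (\<lambda>x. h (Suc n) (p x) * frechet_derivative p (at x) v)" for v
      using Suc.prems Ck_on_SucD[OF Suc.prems]
      by (intro bounded_bilinear.Ck_on[OF bounded_bilinear_mult] Suc.IH assms) auto
  qed
qed

lemma smooth_on_cong: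
  "open S \<Longrightarrow> (\<And>x. x \<in> S \<Longrightarrow> f x = g x) \<Longrightarrow> smooth_on S f \<Longrightarrow> smooth_on S g"
  using Ck_on_cong unfolding smooth_on_def by blast

lemma smooth_on_frechet_derivative:
  "smooth_on S f \<Longrightarrow> smooth_on S (\<lambda>x. frechet_derivative f (at x) v)"
  unfolding smooth_on_def by (metis Ck_on.simps(2))

lemma smooth_on_has_derivative:
  "smooth_on S f \<Longrightarrow> x \<in> S \<Longrightarrow> (f has_derivative frechet_derivative f (at x)) (at x)"
  unfolding smooth_on_def using Ck_on_has_derivative by blast

lemma smooth_on_imp_continuous_on: "smooth_on S f \<Longrightarrow> continuous_on S f"
  unfolding smooth_on_def by (metis Ck_on.simps(1))

lemma smooth_on_const: "open S \<Longrightarrow> smooth_on S (\<lambda>x. c)"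
  by (simp add: smooth_on_def Ck_on_const)

lemma smooth_on_linear: "open S \<Longrightarrow> bounded_linear L \<Longrightarrow> smooth_on S L"
  by (simp add: smooth_on_def Ck_on_linear)

lemma smooth_on_add:
  "open S \<Longrightarrow> smooth_on S f \<Longrightarrow> smooth_on S g \<Longrightarrow> smooth_on S (\<lambda>x. f x + g x)"
  by (simp add: smooth_on_def Ck_on_add)

lemma smooth_on_mult:
  fixes f g :: "'a::real_normed_vector \<Rightarrow> 'b::real_normed_algebra"
  shows "open S \<Longrightarrow> smooth_on S f \<Longrightarrow> smooth_on S g \<Longrightarrow> smooth_on S (\<lambda>x. f x * g x)"
  by (simp add: smooth_on_def bounded_bilinear.Ck_on[OF bounded_bilinear_mult])

lemma smooth_on_scaleR:
  "open S \<Longrightarrow> smooth_on S f \<Longrightarrow> smooth_on S g \<Longrightarrow> smooth_on S (\<lambda>x. f x *\<^sub>R g x)"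
  by (simp add: smooth_on_def bounded_bilinear.Ck_on[OF bounded_bilinear_scaleR])

lemma smooth_on_compose_real:
  fixes h :: "nat \<Rightarrow> real \<Rightarrow> real"
  assumes "open S" "\<And>n t. t \<in> J \<Longrightarrow> (h n has_real_derivative h (Suc n) t) (at t)"
    "p ` S \<subseteq> J" "smooth_on S p"
  shows "smooth_on S (\<lambda>x. h n (p x))"
  using assms(4) Ck_on_compose_real[where h = h and J = J, OF assms(1) _ assms(3)] assms(2) by (simp add: smooth_on_def)

lemma smooth_on_sum:
  "open S \<Longrightarrow> (\<And>i. i \<in> I \<Longrightarrow> smooth_on S (f i)) \<Longrightarrow> smooth_on S (\<lambda>x. \<Sum>i\<in>I. f i x)"
  by (induction I rule: infinite_finite_induct) (auto simp: smooth_on_const smooth_on_add)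

lemma smooth_on_prod:
  fixes f :: "'i \<Rightarrow> 'a::real_normed_vector \<Rightarrow> 'b::{real_normed_algebra_1,comm_ring_1}"
  shows "open S \<Longrightarrow> (\<And>i. i \<in> I \<Longrightarrow> smooth_on S (f i)) \<Longrightarrow> smooth_on S (\<lambda>x. \<Prod>i\<in>I. f i x)"
  by (induction I rule: infinite_finite_induct) (auto simp: smooth_on_const smooth_on_mult)

text \<open>The increment of \<open>g\<close> over a parallelogram is symmetric in its two sides; dividing by \<open>s * t\<close> and
  letting \<open>s, t\<close> tend to 0 it approximates either mixed derivative.\<close>

lemma second_difference_bound:
  fixes g :: "'a::real_normed_vector \<Rightarrow> 'b::real_normed_vector"
  assumes s: "0 \<le> s" and t: "0 \<le> t"
    and g: "\<And>\<sigma> \<tau>. 0 \<le> \<sigma> \<Longrightarrow> \<sigma> \<le> s \<Longrightarrow> 0 \<le> \<tau> \<Longrightarrow> \<tau> \<le> t \<Longrightarrow>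
        (g has_derivative g' (x + \<sigma> *\<^sub>R u + \<tau> *\<^sub>R v)) (at (x + \<sigma> *\<^sub>R u + \<tau> *\<^sub>R v))"
    and gu: "\<And>\<sigma> \<tau>. 0 \<le> \<sigma> \<Longrightarrow> \<sigma> \<le> s \<Longrightarrow> 0 \<le> \<tau> \<Longrightarrow> \<tau> \<le> t \<Longrightarrow>
        ((\<lambda>y. g' y u) has_derivative gu' (x + \<sigma> *\<^sub>R u + \<tau> *\<^sub>R v)) (at (x + \<sigma> *\<^sub>R u + \<tau> *\<^sub>R v))"
    and B: "\<And>\<sigma> \<tau>. 0 \<le> \<sigma> \<Longrightarrow> \<sigma> \<le> s \<Longrightarrow> 0 \<le> \<tau> \<Longrightarrow> \<tau> \<le> t \<Longrightarrow>
        norm (gu' (x + \<sigma> *\<^sub>R u + \<tau> *\<^sub>R v) v - L) \<le> e"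
  shows "norm (g (x + s *\<^sub>R u + t *\<^sub>R v) - g (x + s *\<^sub>R u) - g (x + t *\<^sub>R v) + g x - (s * t) *\<^sub>R L) \<le> s * t * e"
proof -
  have 1: "norm (g' (x + \<sigma> *\<^sub>R u + t *\<^sub>R v) u - g' (x + \<sigma> *\<^sub>R u) u - t *\<^sub>R L) \<le> t * e"
    if \<sigma>: "0 \<le> \<sigma>" "\<sigma> \<le> s" for \<sigma>
  proof -
    define F where "F = (\<lambda>\<tau>. g' (x + \<sigma> *\<^sub>R u + \<tau> *\<^sub>R v) u - \<tau> *\<^sub>R L)"
    have "norm (F t - F 0) \<le> e * norm (t - 0)"
    proof (rule differentiable_bound[of "{0..t}"])
      fix \<tau> assume "\<tau> \<in> {0..t}"
      then have \<tau>: "0 \<le> \<tau>" "\<tau> \<le> t" by auto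
      have "((\<lambda>\<tau>. x + \<sigma> *\<^sub>R u + \<tau> *\<^sub>R v) has_derivative (\<lambda>k. k *\<^sub>R v)) (at \<tau>)"
        by (auto intro!: derivative_eq_intros)
      from has_derivative_compose[OF this gu[OF \<sigma> \<tau>]]
      have "((\<lambda>\<tau>. g' (x + \<sigma> *\<^sub>R u + \<tau> *\<^sub>R v) u) has_derivative
          (\<lambda>k. gu' (x + \<sigma> *\<^sub>R u + \<tau> *\<^sub>R v) (k *\<^sub>R v))) (at \<tau>)" .
      moreover have "gu' (x + \<sigma> *\<^sub>R u + \<tau> *\<^sub>R v) (k *\<^sub>R v) = k *\<^sub>R gu' (x + \<sigma> *\<^sub>R u + \<tau> *\<^sub>R v) v" for k
        using gu[OF \<sigma> \<tau>] by (simp add: has_derivative_bounded_linear bounded_linear.linear linear_cmul)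
      ultimately have "(F has_derivative
          (\<lambda>k. k *\<^sub>R (gu' (x + \<sigma> *\<^sub>R u + \<tau> *\<^sub>R v) v - L))) (at \<tau>)"
        unfolding F_def scaleR_diff_right by (auto intro!: derivative_eq_intros)
      then show "(F has_derivative
          (\<lambda>k. k *\<^sub>R (gu' (x + \<sigma> *\<^sub>R u + \<tau> *\<^sub>R v) v - L))) (at \<tau> within {0..t})"
        by (rule has_derivative_at_withinI)
      show "onorm (\<lambda>k. k *\<^sub>R (gu' (x + \<sigma> *\<^sub>R u + \<tau> *\<^sub>R v) v - L)) \<le> e"
        using B[OF \<sigma> \<tau>] by (intro onorm_le) (simp add: mult.commute[of e] mult_left_mono)
    qed (use t in auto)
    then show ?thesis using t by (simp add: F_def algebra_simps)
  qed
  define G where "G = (\<lambda>\<sigma>. g (x + \<sigma> *\<^sub>R u + t *\<^sub>R v) - g (x + \<sigma> *\<^sub>R u) - (\<sigma> * t) *\<^sub>R L)"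
  have "norm (G s - G 0) \<le> (t * e) * norm (s - 0)"
  proof (rule differentiable_bound[of "{0..s}"])
    fix \<sigma> assume "\<sigma> \<in> {0..s}"
    then have \<sigma>: "0 \<le> \<sigma>" "\<sigma> \<le> s" by auto
    have *: "((\<lambda>\<sigma>. g (x + \<sigma> *\<^sub>R u + \<tau> *\<^sub>R v)) has_derivative
        (\<lambda>k. k *\<^sub>R g' (x + \<sigma> *\<^sub>R u + \<tau> *\<^sub>R v) u)) (at \<sigma>)" if \<tau>: "0 \<le> \<tau>" "\<tau> \<le> t" for \<tau>
    proof -
      have "((\<lambda>\<sigma>. x + \<sigma> *\<^sub>R u + \<tau> *\<^sub>R v) has_derivative (\<lambda>k. k *\<^sub>R u)) (at \<sigma>)"
        by (auto intro!: derivative_eq_intros)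
      from has_derivative_compose[OF this g[OF \<sigma> \<tau>]]
      show ?thesis
        using g[OF \<sigma> \<tau>] by (simp add: has_derivative_bounded_linear bounded_linear.linear linear_cmul)
    qed
    have "(G has_derivative
        (\<lambda>k. k *\<^sub>R (g' (x + \<sigma> *\<^sub>R u + t *\<^sub>R v) u - g' (x + \<sigma> *\<^sub>R u) u - t *\<^sub>R L))) (at \<sigma>)"
      unfolding G_def using *[of t] *[of 0] t
      by (auto intro!: derivative_eq_intros simp: algebra_simps)
    then show "(G has_derivative
        (\<lambda>k. k *\<^sub>R (g' (x + \<sigma> *\<^sub>R u + t *\<^sub>R v) u - g' (x + \<sigma> *\<^sub>R u) u - t *\<^sub>R L))) (at \<sigma> within {0..s})"
      by (rule has_derivative_at_withinI)
    show "onorm (\<lambda>k. k *\<^sub>R (g' (x + \<sigma> *\<^sub>R u + t *\<^sub>R v) u - g' (x + \<sigma> *\<^sub>R u) u - t *\<^sub>R L)) \<le> t * e"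
      using 1[OF \<sigma>] by (intro onorm_le) (simp add: mult.commute[of "t * e"] mult_left_mono)
  qed (use s in auto)
  then show ?thesis using s by (simp add: G_def algebra_simps)
qed

lemma frechet_derivative_commute:
  fixes g :: "'a::real_normed_vector \<Rightarrow> 'b::real_normed_vector"
  assumes "open S" "x \<in> S" "Ck_on 2 S g"
  shows "frechet_derivative (\<lambda>y. frechet_derivative g (at y) u) (at x) v =
         frechet_derivative (\<lambda>y. frechet_derivative g (at y) v) (at x) u"
    (is "?D u v x = ?D v u x")
proof (rule ccontr)
  assume neq: "?D u v x \<noteq> ?D v u x"
  \<comment> \<open>The same second difference approximates both mixed derivatives within
    \<open>e\<close>, so they differ by at most \<open>2 * e\<close>; a third of the supposed
    distance makes this a contradiction.\<close>
  define e where "e = norm (?D u v x - ?D v u x) / 3"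
  have e: "e > 0" using neq by (simp add: e_def)
  have C: "Ck_on (Suc (Suc 0)) S g" using assms(3) by (simp add: numeral_2_eq_2)
  have g: "y \<in> S \<Longrightarrow> (g has_derivative frechet_derivative g (at y)) (at y)" for y
    using Ck_on_has_derivative[OF C] .
  have g2: "y \<in> S \<Longrightarrow> ((\<lambda>y. frechet_derivative g (at y) u) has_derivative
      frechet_derivative (\<lambda>y. frechet_derivative g (at y) u) (at y)) (at y)" for y u
    using Ck_on_has_derivative[of 0 S "\<lambda>y. frechet_derivative g (at y) u"] C by simp
  have cont: "isCont (?D u v) x" for u v
    using C assms(1,2) continuous_on_eq_continuous_at by (metis Ck_on.simps)
  from cont[of u v] obtain d1 where d1: "d1 > 0" "\<And>y. dist y x < d1 \<Longrightarrow> dist (?D u v y) (?D u v x) < e"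
    using e unfolding continuous_at_eps_delta by blast
  from cont[of v u] obtain d2 where d2: "d2 > 0" "\<And>y. dist y x < d2 \<Longrightarrow> dist (?D v u y) (?D v u x) < e"
    using e unfolding continuous_at_eps_delta by blast
  obtain d3 where d3: "d3 > 0" "ball x d3 \<subseteq> S"
    using assms(1,2) open_contains_ball by blast
  define d where "d = min d1 (min d2 d3)"
  \<comment> \<open>This side length keeps the whole parallelogram within distance \<open>d\<close>
    of \<open>x\<close>; the summand 1 covers the case that \<open>u\<close> and \<open>v\<close>
    both vanish.\<close>
  define s where "s = d / (norm u + norm v + 1)"
  have d: "d > 0" using d1 d2 d3 by (simp add: d_def)
  have pos: "norm u + norm v + 1 > 0" by (simp add: add_nonneg_pos)
  have s: "s > 0" unfolding s_def using d pos by simp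
  have near: "dist (x + \<sigma> *\<^sub>R u + \<tau> *\<^sub>R v) x < d"
    if "0 \<le> \<sigma>" "\<sigma> \<le> s" "0 \<le> \<tau>" "\<tau> \<le> s" for \<sigma> \<tau>
  proof -
    have "dist (x + \<sigma> *\<^sub>R u + \<tau> *\<^sub>R v) x \<le> norm (\<sigma> *\<^sub>R u) + norm (\<tau> *\<^sub>R v)"
      by (metis add.assoc add_diff_cancel_left' dist_norm norm_triangle_ineq)
    also have "\<dots> \<le> s * norm u + s * norm v"
      using that by (auto intro!: add_mono mult_right_mono)
    also have "\<dots> < s * (norm u + norm v + 1)" using s by (simp add: algebra_simps)
    also have "\<dots> = d" using pos by (simp add: s_def)
    finally show ?thesis .
  qed
  have inS: "x + \<sigma> *\<^sub>R u + \<tau> *\<^sub>R v \<in> S" "x + \<tau> *\<^sub>R v + \<sigma> *\<^sub>R u \<in> S"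
    if "0 \<le> \<sigma>" "\<sigma> \<le> s" "0 \<le> \<tau>" "\<tau> \<le> s" for \<sigma> \<tau>
    using near[OF that] d3(2) by (auto simp: d_def dist_commute subset_iff ac_simps)
  let ?\<Delta> = "g (x + s *\<^sub>R u + s *\<^sub>R v) - g (x + s *\<^sub>R u) - g (x + s *\<^sub>R v) + g x"
  have 1: "norm (?\<Delta> - (s * s) *\<^sub>R ?D u v x) \<le> s * s * e"
  proof (rule second_difference_bound[where g' = "\<lambda>y. frechet_derivative g (at y)" and
      gu' = "\<lambda>y. frechet_derivative (\<lambda>y. frechet_derivative g (at y) u) (at y)"])
    fix \<sigma> \<tau> assume *: "0 \<le> \<sigma>" "\<sigma> \<le> s" "0 \<le> \<tau>" "\<tau> \<le> s"
    show "norm (?D u v (x + \<sigma> *\<^sub>R u + \<tau> *\<^sub>R v) - ?D u v x) \<le> e"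
      using d1(2)[of "x + \<sigma> *\<^sub>R u + \<tau> *\<^sub>R v"] near[OF *] by (simp add: dist_norm d_def)
  qed (use s g g2 inS in auto)
  have 2: "norm (g (x + s *\<^sub>R v + s *\<^sub>R u) - g (x + s *\<^sub>R v) - g (x + s *\<^sub>R u) + g x - (s * s) *\<^sub>R ?D v u x) \<le> s * s * e"
  proof (rule second_difference_bound[where g' = "\<lambda>y. frechet_derivative g (at y)" and
      gu' = "\<lambda>y. frechet_derivative (\<lambda>y. frechet_derivative g (at y) v) (at y)"])
    fix \<tau> \<sigma> assume *: "0 \<le> \<tau>" "\<tau> \<le> s" "0 \<le> \<sigma>" "\<sigma> \<le> s"
    show "norm (?D v u (x + \<tau> *\<^sub>R v + \<sigma> *\<^sub>R u) - ?D v u x) \<le> e"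
      using d2(2)[of "x + \<tau> *\<^sub>R v + \<sigma> *\<^sub>R u"] near[OF *(3,4,1,2)] by (simp add: dist_norm d_def ac_simps)
  qed (use s g g2 inS in auto)
  have 3: "norm (?\<Delta> - (s * s) *\<^sub>R ?D v u x) \<le> s * s * e"
    using 2 by (simp add: algebra_simps)
  have "(s * s) *\<^sub>R (?D u v x - ?D v u x) =
      (?\<Delta> - (s * s) *\<^sub>R ?D v u x) - (?\<Delta> - (s * s) *\<^sub>R ?D u v x)"
    by (simp add: algebra_simps)
  also have "norm \<dots> \<le> s * s * e + s * s * e"
    using norm_triangle_le_diff[OF add_mono[OF 3 1]] by simp
  finally have "(s * s) * norm (?D u v x - ?D v u x) \<le> (s * s) * (2 * e)"
    by (simp add: ac_simps)
  then have "norm (?D u v x - ?D v u x) \<le> 2 * e"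
    using s mult_le_cancel_left_pos[of "s * s" "norm (?D u v x - ?D v u x)" "2 * e"] by simp
  then show False using e by (simp add: e_def)
qed

section \<open>A smooth cutoff function\<close>

text \<open>The extra power of \<open>y\<close> carries the induction, since splitting off the
  constant coefficient of \<open>p\<close> raises it by one. The instance \<open>k = 1\<close> is
  the difference quotient of \<open>flat_deriv\<close> at 0.\<close>

lemma poly_over_exp_tendsto_0:
  "((\<lambda>y::real. y ^ k * poly p y / exp y) \<longlongrightarrow> 0) at_top"
proof (induction p arbitrary: k)
  case 0
  then show ?case by simp
next
  case (pCons a p)
  have "((\<lambda>y::real. a * (y ^ k / exp y) + y ^ Suc k * poly p y / exp y) \<longlongrightarrow> a * 0 + 0) at_top"
    by (intro tendsto_intros pCons.IH tendsto_power_div_exp_0)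
  then show ?case by (simp add: field_simps)
qed

text \<open>The \<open>n\<close>-th derivative of \<open>exp (- 1/t)\<close> (extended by 0 to \<open>t \<le> 0\<close>) is a polynomial in \<open>1/t\<close>
  times \<open>exp (- 1/t)\<close>.\<close>

primrec flat_poly :: "nat \<Rightarrow> real poly" where
  "flat_poly 0 = 1"
| "flat_poly (Suc n) = monom 1 2 * (flat_poly n - pderiv (flat_poly n))"

definition flat_deriv :: "nat \<Rightarrow> real \<Rightarrow> real" where
  "flat_deriv n t = (if t \<le> 0 then 0 else poly (flat_poly n) (inverse t) * exp (- inverse t))"

lemma flat_deriv_has_derivative:
  "(flat_deriv n has_real_derivative flat_deriv (Suc n) t) (at t)"
proof -
  consider "t < 0" | "t = 0" | "t > 0" by linarith
  then show ?thesis
  proof cases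
    case 1
    show ?thesis
    proof (rule has_field_derivative_transform_within[of "\<lambda>_. 0" _ _ UNIV])
      show "((\<lambda>_. 0) has_real_derivative flat_deriv (Suc n) t) (at t)"
        using 1 by (simp add: flat_deriv_def)
      show "t \<in> UNIV" by simp
      show "0 < - t" using 1 by simp
      show "0 = flat_deriv n x" if "dist x t < - t" for x
        using that 1 by (auto simp: flat_deriv_def dist_real_def)
    qed
  next
    case 3
    show ?thesis
    proof (rule has_field_derivative_transform_within[of "\<lambda>x. poly (flat_poly n) (inverse x) * exp (- inverse x)" _ _ UNIV])
      show "((\<lambda>x. poly (flat_poly n) (inverse x) * exp (- inverse x)) has_real_derivative
          flat_deriv (Suc n) t) (at t)"
        using 3 by (auto intro!: derivative_eq_intros DERIV_chain2[OF poly_DERIV] 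
            simp: flat_deriv_def poly_monom power2_eq_square algebra_simps)
      show "t \<in> UNIV" by simp
      show "0 < t" by fact
      show "poly (flat_poly n) (inverse x) * exp (- inverse x) = flat_deriv n x" if "dist x t < t" for x
        using that 3 by (auto simp: flat_deriv_def dist_real_def)
    qed
  next
    case 2
    have "((\<lambda>h. (flat_deriv n (0 + h) - flat_deriv n 0) / h) \<longlongrightarrow> 0) (at 0)"
    proof (rule filterlim_split_at)
      show "((\<lambda>h. (flat_deriv n (0 + h) - flat_deriv n 0) / h) \<longlongrightarrow> 0) (at_left 0)"
        by (rule tendsto_eventually)
          (auto simp: flat_deriv_def eventually_at intro!: exI[of _ 1])
      \<comment> \<open>With \<open>y = 1/h\<close> the division by \<open>h\<close> becomes one
        more factor \<open>y\<close>, which the exponential still dominates.\<close>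
      have "((\<lambda>h. (inverse h) ^ 1 * poly (flat_poly n) (inverse h) / exp (inverse h)) \<longlongrightarrow> 0) (at_right (0::real))"
        by (rule filterlim_compose[OF poly_over_exp_tendsto_0 filterlim_inverse_at_top_right])
      then show "((\<lambda>h. (flat_deriv n (0 + h) - flat_deriv n 0) / h) \<longlongrightarrow> 0) (at_right 0)"
        by (rule Lim_transform_eventually)
          (auto simp: flat_deriv_def eventually_at exp_minus field_simps intro!: exI[of _ 1])
    qed
    then show ?thesis
      using 2 by (simp add: DERIV_def flat_deriv_def)
  qed
qed

text \<open>Supplies, for a smooth real function, the sequence of successive derivatives that
  \<open>smooth_on_compose_real\<close> expects.\<close>

lemma smooth_on_iterated_deriv:
  fixes f :: "real \<Rightarrow> real"
  assumes "smooth_on UNIV f"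
  shows "smooth_on UNIV ((deriv ^^ n) f)"
    and "((deriv ^^ n) f has_real_derivative (deriv ^^ Suc n) f t) (at t)"
proof -
  have *: "smooth_on UNIV (deriv g)" "(g has_real_derivative deriv g t) (at t)"
    if g: "smooth_on UNIV g" for g :: "real \<Rightarrow> real" and t
  proof -
    have d: "(g has_real_derivative frechet_derivative g (at t) 1) (at t)" for t
    proof -
      have "(g has_derivative frechet_derivative g (at t)) (at t)"
        using smooth_on_has_derivative[OF g] by simp
      moreover have "frechet_derivative g (at t) x = frechet_derivative g (at t) 1 * x" for x
        using linear_cmul[OF bounded_linear.linear[OF has_derivative_bounded_linear[OF calculation]], of x 1]
        by simp
      ultimately show ?thesis unfolding has_field_derivative_def
        by (metis ext)
    qed
    then have "deriv g = (\<lambda>t. frechet_derivative g (at t) 1)"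
      by (auto intro: DERIV_imp_deriv)
    then show "smooth_on UNIV (deriv g)" "(g has_real_derivative deriv g t) (at t)"
      using d g smooth_on_frechet_derivative[of UNIV g 1] by auto
  qed
  show "smooth_on UNIV ((deriv ^^ n) f)"
    by (induction n) (auto simp: assms *)
  then show "((deriv ^^ n) f has_real_derivative (deriv ^^ Suc n) f t) (at t)"
    using * by simp
qed

text \<open>With \<open>F t = exp (- 1/t)\<close> for \<open>t > 0\<close> and 0 otherwise, this is
  \<open>e * F (1 - e^2 * F (t - 1/2))\<close>. For \<open>t \<le> 1/2\<close> the inner
  \<open>F\<close> vanishes and \<open>e * F 1 = 1\<close>. For \<open>t \<ge> 1\<close> one has
  \<open>F (t - 1/2) \<ge> e^(-2)\<close>, so the outer argument is not positive and the value is 0.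
  Composing \<open>F\<close> with itself avoids quotients and integrals.\<close>

definition cutoff :: "real \<Rightarrow> real" where
  "cutoff t = exp 1 * flat_deriv 0 (1 - exp 2 * flat_deriv 0 (t - 1 / 2))"

lemma smooth_on_cutoff: "smooth_on UNIV cutoff"
proof -
  have comp: "smooth_on UNIV (\<lambda>t. flat_deriv 0 (p t))" if "smooth_on UNIV p" for p :: "real \<Rightarrow> real"
    using smooth_on_compose_real[of UNIV UNIV flat_deriv p 0] flat_deriv_has_derivative that by auto
  have "smooth_on UNIV (\<lambda>t::real. t + (- 1/2))"
    by (rule smooth_on_add[OF open_UNIV smooth_on_linear[OF open_UNIV bounded_linear_ident]
          smooth_on_const[OF open_UNIV]])
  then have "smooth_on UNIV (\<lambda>t. (- exp 2) * flat_deriv 0 (t + (- 1/2)))"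
    by (rule smooth_on_mult[OF open_UNIV smooth_on_const[OF open_UNIV] comp])
  then have "smooth_on UNIV (\<lambda>t. flat_deriv 0 (1 + (- exp 2) * flat_deriv 0 (t + (- 1/2))))"
    by (rule comp[OF smooth_on_add[OF open_UNIV smooth_on_const[OF open_UNIV]]])
  then have "smooth_on UNIV (\<lambda>t. exp 1 * flat_deriv 0 (1 + (- exp 2) * flat_deriv 0 (t + (- 1/2))))"
    by (rule smooth_on_mult[OF open_UNIV smooth_on_const[OF open_UNIV]])
  then show ?thesis by (simp add: cutoff_def[abs_def])
qed

lemma cutoff_eq_1: "t \<le> 1/2 \<Longrightarrow> cutoff t = 1"
  by (simp add: cutoff_def flat_deriv_def flip: exp_add)

lemma cutoff_eq_0:
  assumes "t \<ge> 1" shows "cutoff t = 0"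
proof -
  have "inverse (t - 1/2) \<le> 2"
    using assms le_imp_inverse_le[of "1/2" "t - 1/2"] by simp
  then have "1 \<le> exp (2 - inverse (t - 1/2))" by simp
  then have "1 \<le> exp 2 * exp (- inverse (t - 1/2))" by (simp flip: exp_add)
  then show ?thesis using assms by (simp add: cutoff_def flat_deriv_def)
qed

lemma cutoff_deriv_eq_0:
  assumes "t > 1" shows "(deriv ^^ n) cutoff t = 0"
  using assms
proof (induction n arbitrary: t)
  case 0
  then show ?case by (simp add: cutoff_eq_0)
next
  case (Suc n)
  have "((deriv ^^ n) cutoff has_real_derivative 0) (at t)"
  proof (rule has_field_derivative_transform_within[of "\<lambda>_. 0" _ _ UNIV])
    show "t \<in> UNIV" by simp
    show "0 < t - 1" using Suc.prems by simp
    show "0 = (deriv ^^ n) cutoff x" if "dist x t < t - 1" for x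
      using Suc.IH[of x] that by (auto simp: dist_real_def)
  qed simp
  then show ?case by (simp add: DERIV_imp_deriv)
qed

text \<open>Continuity on the compact interval \<open>[0, 1]\<close> and vanishing beyond it.
  Nonnegative \<open>t\<close> suffice because the argument will be
  \<open>||x||^2 / d\<close>.\<close>

lemma cutoff_deriv_bounded:
  obtains B where "B \<ge> 0" "\<And>t. t \<ge> 0 \<Longrightarrow> \<bar>(deriv ^^ n) cutoff t\<bar> \<le> B"
proof -
  have "continuous_on {0..1} ((deriv ^^ n) cutoff)"
    using smooth_on_imp_continuous_on[OF smooth_on_iterated_deriv(1)[OF smooth_on_cutoff]]
    by (rule continuous_on_subset) simp
  then have "bounded ((deriv ^^ n) cutoff ` {0..1})"
    by (intro compact_imp_bounded compact_continuous_image) auto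
  then obtain B where B: "\<And>t. t \<in> {0..1} \<Longrightarrow> \<bar>(deriv ^^ n) cutoff t\<bar> \<le> B"
    unfolding bounded_iff by fastforce
  have "B \<ge> 0" using B[of 0] by simp
  moreover have "\<bar>(deriv ^^ n) cutoff t\<bar> \<le> B" if "t \<ge> 0" for t
    using B[of t] cutoff_deriv_eq_0[of t n] that \<open>B \<ge> 0\<close> by (cases "t \<le> 1") auto
  ultimately show ?thesis using that by blast
qed

section \<open>Words in the operators \<open>T i\<close>\<close>

lemma orthant_nth: "x \<in> orthant \<Longrightarrow> 0 < x $ i"
  by (simp add: orthant_def)

lemma open_orthant: "open (orthant :: (real ^ 'n) set)"
proof -
  have "(orthant :: (real ^ 'n) set) = (\<Inter>i. {x. 0 < x $ i})"
    by (auto simp: orthant_def)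
  also have "open \<dots>"
    by (intro open_INT ballI open_Collect_less continuous_intros) simp
  finally show ?thesis .
qed

lemma convex_orthant: "convex (orthant :: (real ^ 'n) set)"
  unfolding convex_def orthant_def
proof (clarsimp)
  fix x y :: "real ^ 'n" and u v :: real and i
  assume "\<forall>i. 0 < x $ i" "\<forall>i. 0 < y $ i" "0 \<le> u" "0 \<le> v" "u + v = 1"
  then show "0 < u * x $ i + v * y $ i"
    by (cases "u = 0") (auto intro!: add_pos_nonneg intro: mult_nonneg_nonneg less_imp_le)
qed

lemma scaleR_orthant: "x \<in> orthant \<Longrightarrow> 0 < s \<Longrightarrow> s *\<^sub>R x \<in> orthant"
  by (simp add: orthant_def)

lemma vec_1_in_orthant: "(1 :: real ^ 'n) \<in> orthant"
  by (simp add: orthant_def)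

lemma norm_power2_vec: "(norm (x :: real ^ 'n))\<^sup>2 = (\<Sum>i\<in>UNIV. (x $ i)\<^sup>2)"
  by (simp only: power2_norm_eq_inner inner_vec_def) (simp add: power2_eq_square)

lemma smooth_on_nth_powr: "smooth_on orthant (\<lambda>x :: real ^ 'n. (x $ i) powr a)"
proof -
  \<comment> \<open>\<open>h n\<close> is the \<open>n\<close>-th derivative of
    \<open>t powr a\<close>, with a falling factorial as coefficient.\<close>
  define h where "h = (\<lambda>n t. (\<Prod>j<n. a - real j) * t powr (a - real n))"
  have "(h n has_real_derivative h (Suc n) t) (at t)" if "t \<in> {0<..}" for n t
  proof -
    have "((\<lambda>t. t powr (a - real n)) has_real_derivative (a - real n) * t powr (a - real n - 1)) (at t)"
      using that by (intro has_real_derivative_powr) simp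
    from DERIV_cmult[OF this, of "\<Prod>j<n. a - real j"] show ?thesis
      by (simp add: h_def mult.assoc diff_diff_eq add.commute)
  qed
  moreover have "(\<lambda>x :: real ^ 'n. x $ i) ` orthant \<subseteq> {0<..}"
    by (auto simp: orthant_def)
  ultimately have "smooth_on orthant (\<lambda>x :: real ^ 'n. h 0 (x $ i))"
    using smooth_on_linear[OF open_orthant bounded_linear_vec_nth]
    by (rule smooth_on_compose_real[OF open_orthant])
  then show ?thesis by (simp add: h_def)
qed

lemma smooth_on_mpow: "smooth_on orthant (\<lambda>x. mpow x a)"
  unfolding mpow_def by (intro smooth_on_prod open_orthant smooth_on_nth_powr)

lemma smooth_on_weighted: "smooth_on orthant \<phi> \<Longrightarrow> smooth_on orthant (weighted \<mu> \<phi>)"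
  unfolding weighted_def by (intro smooth_on_scaleR open_orthant smooth_on_mpow)

lemma T_eq:
  assumes "smooth_on orthant g" "x \<in> orthant"
  shows "T i g x = inverse (x $ i) *\<^sub>R frechet_derivative g (at x) (axis i 1)"
proof -
  have d: "(g has_derivative frechet_derivative g (at x)) (at x)"
    using assms smooth_on_has_derivative by blast
  have "((\<lambda>t. x + t *\<^sub>R axis i 1) has_derivative (\<lambda>t. t *\<^sub>R axis i 1)) (at 0)"
    by (auto intro!: derivative_eq_intros)
  from has_derivative_compose[OF this, of g "frechet_derivative g (at x)"]
  have "((\<lambda>t. g (x + t *\<^sub>R axis i 1)) has_derivative
      (\<lambda>t. frechet_derivative g (at x) (t *\<^sub>R axis i 1))) (at 0)"
    using d by simp
  moreover have "frechet_derivative g (at x) (t *\<^sub>R axis i 1) = t *\<^sub>R frechet_derivative g (at x) (axis i 1)" for t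
    using d by (simp add: has_derivative_bounded_linear bounded_linear.linear linear_cmul)
  ultimately have "((\<lambda>t. g (x + t *\<^sub>R axis i 1)) has_vector_derivative
      frechet_derivative g (at x) (axis i 1)) (at 0)"
    by (simp add: has_vector_derivative_def)
  then show ?thesis
    by (simp add: T_def partial_def vector_derivative_at)
qed

lemma T_has_derivative_eq:
  assumes "smooth_on orthant g" "x \<in> orthant" "(g has_derivative g') (at x)"
  shows "T i g x = inverse (x $ i) *\<^sub>R g' (axis i 1)"
  using T_eq[OF assms(1,2)] frechet_derivative_at[OF assms(3)] by simp

lemma T_cong:
  assumes "smooth_on orthant f" "\<And>x. x \<in> orthant \<Longrightarrow> f x = g x" "x \<in> orthant"
  shows "T i f x = T i g x"
proof -
  have "smooth_on orthant g" using smooth_on_cong[OF open_orthant assms(2,1)] .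
  moreover have "frechet_derivative f (at x) = frechet_derivative g (at x)"
    using assms open_orthant smooth_on_has_derivative[OF assms(1,3)]
    by (intro frechet_derivative_transform_within_open) (auto simp: differentiable_def)
  ultimately show ?thesis using assms by (simp add: T_eq)
qed

lemma smooth_on_T:
  fixes g :: "real ^ 'n \<Rightarrow> complex"
  assumes "smooth_on orthant g" shows "smooth_on orthant (T i g)"
proof (rule smooth_on_cong[OF open_orthant])
  show "smooth_on orthant (\<lambda>x. ((x $ i) powr (- 1)) *\<^sub>R frechet_derivative g (at x) (axis i 1))"
    by (intro smooth_on_scaleR open_orthant smooth_on_nth_powr smooth_on_frechet_derivative assms)
  show "((x $ i) powr (- 1)) *\<^sub>R frechet_derivative g (at x) (axis i 1) = T i g x"
    if "x \<in> orthant" for x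
    using T_eq[OF assms that] orthant_nth[OF that, of i] by (simp add: powr_minus_divide inverse_eq_divide)
qed

lemma T_add:
  assumes "smooth_on orthant f" "smooth_on orthant g" "x \<in> orthant"
  shows "T i (\<lambda>x. f x + g x) x = T i f x + T i g x"
  using T_has_derivative_eq[OF smooth_on_add[OF open_orthant assms(1,2)] assms(3)
      has_derivative_add[OF smooth_on_has_derivative[OF assms(1,3)] smooth_on_has_derivative[OF assms(2,3)]]]
  by (simp add: T_eq assms scaleR_add_right)

lemma T_mult:
  assumes "smooth_on orthant f" "smooth_on orthant g" "x \<in> orthant"
  shows "T i (\<lambda>x. f x * g x) x = T i f x * g x + f x * T i g x"
  using T_has_derivative_eq[OF smooth_on_mult[OF open_orthant assms(1,2)] assms(3)
      has_derivative_mult[OF smooth_on_has_derivative[OF assms(1,3)] smooth_on_has_derivative[OF assms(2,3)]]]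
  by (simp add: T_eq assms scaleR_add_right)

lemma T_const: "x \<in> orthant \<Longrightarrow> T i (\<lambda>_. c) x = 0"
  using T_has_derivative_eq[OF smooth_on_const[OF open_orthant] _ has_derivative_const] by simp

text \<open>For distinct indices the coefficient \<open>1/x_j\<close> is constant in direction
  \<open>i\<close>, so it passes through \<open>T i\<close> and leaves \<open>1/(x_i x_j)\<close>
  times a mixed second derivative, which is symmetric.\<close>

lemma T_commute:
  fixes g :: "real ^ 'n \<Rightarrow> complex"
  assumes "smooth_on orthant g" "x \<in> orthant"
  shows "T i (T j g) x = T j (T i g) x"
proof (cases "i = j")
  case False
  have *: "T i (T j g) x = (inverse (x $ i) * inverse (x $ j)) *\<^sub>R
      frechet_derivative (\<lambda>y. frechet_derivative g (at y) (axis j 1)) (at x) (axis i 1)"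
    if "i \<noteq> j" for i j
  proof -
    let ?D = "\<lambda>y. frechet_derivative g (at y) (axis j 1)"
    have D: "smooth_on orthant ?D" using assms(1) by (rule smooth_on_frechet_derivative)
    have xj: "x $ j \<noteq> 0" using assms(2) orthant_nth[of x j] by simp
    have sm: "smooth_on orthant (\<lambda>x. inverse (x $ j) *\<^sub>R ?D x)"
      by (rule smooth_on_cong[OF open_orthant _ smooth_on_T[OF assms(1), of j]]) (simp add: T_eq assms)
    have "((\<lambda>y. inverse (y $ j)) has_derivative
        (\<lambda>v. - (inverse (x $ j) * (v $ j) * inverse (x $ j)))) (at x)"
      using xj by (auto intro!: derivative_eq_intros bounded_linear_imp_has_derivative bounded_linear_vec_nth)
    from has_derivative_scaleR[OF this smooth_on_has_derivative[OF D assms(2)]]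
    have "T i (\<lambda>x. inverse (x $ j) *\<^sub>R ?D x) x =
        (inverse (x $ i) * inverse (x $ j)) *\<^sub>R frechet_derivative ?D (at x) (axis i 1)"
      using T_has_derivative_eq[OF sm assms(2), of _ i] that by (simp add: axis_def)
    moreover have "T i (T j g) x = T i (\<lambda>x. inverse (x $ j) *\<^sub>R ?D x) x"
      by (rule T_cong[OF smooth_on_T[OF assms(1)] _ assms(2)]) (simp add: T_eq assms)
    ultimately show ?thesis by simp
  qed
  have "Ck_on 2 orthant g" using assms(1) by (simp add: smooth_on_def)
  from frechet_derivative_commute[OF open_orthant assms(2) this]
  show ?thesis using *[of i j] *[of j i] False by (simp add: mult.commute)
qed simp

text \<open>The last letter acts first. Prefixing a letter adds one operator outside, which suits
  induction, and no ordering of the letters is imposed.\<close>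

definition T_word :: "'n list \<Rightarrow> (real ^ 'n \<Rightarrow> complex) \<Rightarrow> real ^ 'n \<Rightarrow> complex" where
  "T_word w = foldr T w"

lemma T_word_simps [simp]: "T_word [] g = g" "T_word (i # w) g = T i (T_word w g)"
  "T_word (v @ w) g = T_word v (T_word w g)"
  by (simp_all add: T_word_def)

lemma smooth_on_T_word: "smooth_on orthant g \<Longrightarrow> smooth_on orthant (T_word w g)"
  by (induction w) (auto simp: smooth_on_T)

lemma T_word_cong:
  assumes "smooth_on orthant f" "\<And>x. x \<in> orthant \<Longrightarrow> f x = g x" "x \<in> orthant"
  shows "T_word w f x = T_word w g x"
  using assms(3)
proof (induction w arbitrary: x)
  case (Cons i w)
  then show ?case
    using T_cong[OF smooth_on_T_word[OF assms(1)], of w "T_word w g" x i] by simp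
qed (use assms(2) in simp)

lemma T_word_add:
  assumes "smooth_on orthant f" "smooth_on orthant g" "x \<in> orthant"
  shows "T_word w (\<lambda>x. f x + g x) x = T_word w f x + T_word w g x"
  using assms(3)
proof (induction w arbitrary: x)
  case (Cons i w)
  have "T i (T_word w (\<lambda>x. f x + g x)) x = T i (\<lambda>x. T_word w f x + T_word w g x) x"
    using Cons assms by (intro T_cong smooth_on_T_word smooth_on_add open_orthant) auto
  then show ?case using Cons.prems assms by (simp add: T_add smooth_on_T_word)
qed simp

lemma T_word_cmult:
  assumes "smooth_on orthant f" "x \<in> orthant"
  shows "T_word w (\<lambda>x. c * f x) x = c * T_word w f x"
  using assms(2)
proof (induction w arbitrary: x)
  case (Cons i w)
  have "T i (T_word w (\<lambda>x. c * f x)) x = T i (\<lambda>x. c * T_word w f x) x"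
    using Cons assms by (intro T_cong smooth_on_T_word smooth_on_mult smooth_on_const open_orthant) auto
  then show ?case using Cons.prems assms
    by (simp add: T_const T_mult smooth_on_T_word smooth_on_const open_orthant)
qed simp

text \<open>The innermost \<open>T i\<close> is distributed first, so the two terms have the same shape as the
  original product and each step costs a factor 2.\<close>

lemma T_word_mult_bound:
  assumes "smooth_on orthant a" "smooth_on orthant b" "x \<in> orthant"
    and "\<And>p q. length p + length q = length w \<Longrightarrow> norm (T_word p a x) * norm (T_word q b x) \<le> M"
  shows "norm (T_word w (\<lambda>x. a x * b x) x) \<le> 2 ^ length w * M"
  using assms(1,2,4)
proof (induction w arbitrary: a b rule: rev_induct)
  case Nil
  show ?case using Nil(3)[of "[]" "[]"] by (simp add: norm_mult)
next
  case (snoc i w)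
  note sm = smooth_on_T[OF snoc.prems(1), of i] smooth_on_T[OF snoc.prems(2), of i]
  have "T_word (w @ [i]) (\<lambda>x. a x * b x) x = T_word w (\<lambda>x. T i a x * b x + a x * T i b x) x"
    using snoc.prems assms(3) unfolding T_word_simps
    by (intro T_word_cong smooth_on_T smooth_on_mult open_orthant) (auto simp: T_mult)
  also have "\<dots> = T_word w (\<lambda>x. T i a x * b x) x + T_word w (\<lambda>x. a x * T i b x) x"
    using snoc.prems assms(3) sm by (intro T_word_add smooth_on_mult open_orthant)
  finally have eq: "T_word (w @ [i]) (\<lambda>x. a x * b x) x = \<dots>" .
  have 1: "norm (T_word w (\<lambda>x. T i a x * b x) x) \<le> 2 ^ length w * M"
  proof (rule snoc.IH[OF sm(1) snoc.prems(2)])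
    show "norm (T_word p (T i a) x) * norm (T_word q b x) \<le> M" if "length p + length q = length w" for p q
      using snoc.prems(3)[of "p @ [i]" q] that by simp
  qed
  have 2: "norm (T_word w (\<lambda>x. a x * T i b x) x) \<le> 2 ^ length w * M"
  proof (rule snoc.IH[OF snoc.prems(1) sm(2)])
    show "norm (T_word p a x) * norm (T_word q (T i b) x) \<le> M" if "length p + length q = length w" for p q
      using snoc.prems(3)[of p "q @ [i]"] that by simp
  qed
  show ?case unfolding eq using norm_triangle_mono[OF 1 2] by (simp add: ac_simps)
qed

text \<open>The first letter of \<open>v\<close> occurs somewhere in \<open>w\<close>; commutation
  moves it to the front there, and the remaining letters are handled by induction.\<close>

lemma T_word_mset:
  assumes "smooth_on orthant g" "mset v = mset w" "x \<in> orthant"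
  shows "T_word v g x = T_word w g x"
  using assms(2,3)
proof (induction v arbitrary: w x)
  case (Cons i v)
  have bring: "T_word (a @ i # b) g x = T_word (i # a @ b) g x" if "x \<in> orthant" for a b x
    using that
  proof (induction a arbitrary: x)
    case (Cons j a)
    have "T_word ((j # a) @ i # b) g x = T j (T i (T_word (a @ b) g)) x"
      using Cons smooth_on_T_word[OF assms(1), of "a @ i # b"]
      by (simp del: T_word_simps(3)) (rule T_cong; simp)
    then show ?case
      using T_commute[OF smooth_on_T_word[OF assms(1)] Cons.prems, of j i "a @ b"] by simp
  qed simp
  have "i \<in> set w" using Cons.prems(1) by (metis list.set_intros(1) set_mset_mset)
  then obtain a b where w: "w = a @ i # b" by (meson split_list)
  have IH: "T_word v g z = T_word (a @ b) g z" if "z \<in> orthant" for z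
    using Cons.prems(1) w that by (intro Cons.IH) auto
  have "T i (T_word v g) x = T i (T_word (a @ b) g) x"
    by (rule T_cong[OF smooth_on_T_word[OF assms(1)] IH Cons.prems(2)])
  then show ?case using bring[OF Cons.prems(2), of a b] w by simp
qed simp

text \<open>\<open>Tpow\<close> applies the smallest index first, whereas \<open>foldr\<close>
  starts from the last letter; hence the reversal.\<close>

definition mi_word :: "nat ^ 'n::{finite,linorder} \<Rightarrow> 'n::{finite,linorder} list" where
  "mi_word k = concat (map (\<lambda>i. replicate (k $ i) i) (rev (sorted_list_of_set UNIV)))"

lemma Tpow_eq_T_word: "Tpow k g = T_word (mi_word k) g"
proof -
  have rep: "T_word (replicate m i) g = (T i ^^ m) g" for m i and g :: "real ^ 'n \<Rightarrow> complex"
    by (induction m) auto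
  have "fold (\<lambda>i. T i ^^ (k $ i)) xs g = T_word (concat (map (\<lambda>i. replicate (k $ i) i) (rev xs))) g" for xs
    by (induction xs arbitrary: g) (auto simp: rep)
  then show ?thesis by (simp add: Tpow_def mi_word_def)
qed

lemma count_mi_word: "count (mset (mi_word k)) i = k $ i"
proof -
  have "count (mset (concat (map (\<lambda>i. replicate (k $ i) i) xs))) i = (if i \<in> set xs then k $ i else 0)"
    if "distinct xs" for xs
    using that by (induction xs) auto
  from this[of "rev (sorted_list_of_set UNIV)"] show ?thesis by (simp add: mi_word_def)
qed

lemma length_mi_word: "length (mi_word k) = mi_abs k"
proof -
  have "length (mi_word k) = (\<Sum>i\<in>UNIV. count (mset (mi_word k)) i)"
    using size_multiset_overloaded_eq[of "mset (mi_word k)"]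
    by (simp add: sum.mono_neutral_left not_in_iff flip: size_mset)
  then show ?thesis by (simp add: count_mi_word mi_abs_def)
qed

text \<open>The bridge by which the seminorms and limits, stated for multi-indices, give bounds and
  limits for arbitrary words.\<close>

lemma T_word_eq_Tpow:
  assumes "smooth_on orthant g" "x \<in> orthant"
  shows "T_word w g x = Tpow (\<chi> i. count (mset w) i) g x"
  unfolding Tpow_eq_T_word
  by (rule T_word_mset[OF assms(1) _ assms(2)]) (simp add: multiset_eq_iff count_mi_word)

lemma mi_abs_count:
  fixes w :: "'n::{finite,linorder} list"
  shows "mi_abs (\<chi> i. count (mset w) i) = length w"
proof -
  have "mset (mi_word (\<chi> i. count (mset w) i)) = mset w"
    by (simp add: multiset_eq_iff count_mi_word)
  then show ?thesis by (metis length_mi_word size_mset)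
qed

text \<open>In the variables \<open>s\<^sub>i = x\<^sub>i\<^sup>2 / 2\<close> the operator \<open>T i\<close> is the partial derivative \<open>\<partial>/\<partial>s\<^sub>i\<close>, which is why
  increments are measured by squares of norms.\<close>

lemma T_bound_increment:
  fixes g :: "real ^ 'n \<Rightarrow> complex"
  assumes sm: "smooth_on orthant g" and x: "x \<in> orthant" and y: "y \<in> orthant"
    and B: "\<And>z i. z \<in> closed_segment y x \<Longrightarrow> norm (T i g z) \<le> B"
  shows "norm (g x - g y) \<le> B * ((norm x)\<^sup>2 + (norm y)\<^sup>2)"
proof -
  have B0: "B \<ge> 0" using B[of y undefined] norm_ge_zero order_trans by blast
  define z where "z = (\<lambda>t. y + t *\<^sub>R (x - y))"
  have zseg: "z t \<in> closed_segment y x" if "t \<in> {0..1}" for t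
    using that by (auto simp: z_def closed_segment_def algebra_simps intro!: exI[of _ t])
  have zin: "z t \<in> orthant" if "t \<in> {0..1}" for t
    using zseg[OF that] convex_contains_segment[of orthant] convex_orthant x y by blast
  have "norm (g (z 1) - g (z 0)) \<le> (B * ((norm x)\<^sup>2 + (norm y)\<^sup>2)) * norm (1 - (0::real))"
  proof (rule differentiable_bound[of "{0..1}" "\<lambda>t. g (z t)"
        "\<lambda>t k. k *\<^sub>R frechet_derivative g (at (z t)) (x - y)"])
    fix t :: real assume t: "t \<in> {0..1}"
    have d: "(g has_derivative frechet_derivative g (at (z t))) (at (z t))"
      using smooth_on_has_derivative[OF sm zin[OF t]] .
    then have lin: "linear (frechet_derivative g (at (z t)))"
      by (simp add: has_derivative_bounded_linear bounded_linear.linear)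
    have "(z has_derivative (\<lambda>k. k *\<^sub>R (x - y))) (at t)"
      unfolding z_def by (auto intro!: derivative_eq_intros)
    from has_derivative_compose[OF this d]
    show "((\<lambda>t. g (z t)) has_derivative (\<lambda>k. k *\<^sub>R frechet_derivative g (at (z t)) (x - y))) (at t within {0..1})"
      by (simp add: linear_cmul[OF lin] has_derivative_at_withinI)
    have "x - y = (\<Sum>i\<in>UNIV. (x $ i - y $ i) *\<^sub>R axis i 1)"
      using basis_expansion[of "x - y"] by (simp add: scalar_mult_eq_scaleR)
    then have "frechet_derivative g (at (z t)) (x - y) =
        frechet_derivative g (at (z t)) (\<Sum>i\<in>UNIV. (x $ i - y $ i) *\<^sub>R axis i 1)"
      by (rule arg_cong)
    also have "\<dots> = (\<Sum>i\<in>UNIV. (x $ i - y $ i) *\<^sub>R frechet_derivative g (at (z t)) (axis i 1))"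
      unfolding linear_sum[OF lin] linear_cmul[OF lin] ..
    also have "\<dots> = (\<Sum>i\<in>UNIV. ((x $ i - y $ i) * z t $ i) *\<^sub>R T i g (z t))"
      using orthant_nth[OF zin[OF t]] by (intro sum.cong) (auto simp: T_eq[OF sm zin[OF t]] less_imp_neq[THEN not_sym])
    also have "norm \<dots> \<le> (\<Sum>i\<in>UNIV. ((x $ i)\<^sup>2 + (y $ i)\<^sup>2) * B)"
    proof (rule sum_norm_le)
      fix i
      have xi: "0 < x $ i" "0 < y $ i" using x y orthant_nth by auto
      have zi: "0 < z t $ i" using orthant_nth[OF zin[OF t]] .
      have "z t $ i = (1 - t) * y $ i + t * x $ i" by (simp add: z_def algebra_simps)
      also have "\<dots> \<le> 1 * y $ i + 1 * x $ i" using t xi by (intro add_mono mult_right_mono) auto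
      finally have "z t $ i \<le> x $ i + y $ i" by simp
      \<comment> \<open>A point of the segment has \<open>z_i \<le> x_i + y_i\<close>, and
        \<open>(x_i - y_i) (x_i + y_i)\<close> is the difference of squares, that is, twice the
        increment of \<open>s_i\<close>.\<close>
      then have "\<bar>x $ i - y $ i\<bar> * z t $ i \<le> \<bar>x $ i - y $ i\<bar> * (x $ i + y $ i)"
        by (intro mult_left_mono) auto
      also have "\<dots> = \<bar>(x $ i)\<^sup>2 - (y $ i)\<^sup>2\<bar>"
        using xi by (simp add: power2_eq_square square_diff_square_factored abs_mult)
      also have "\<dots> \<le> (x $ i)\<^sup>2 + (y $ i)\<^sup>2" by (simp add: abs_le_iff)
      finally have "\<bar>x $ i - y $ i\<bar> * z t $ i \<le> (x $ i)\<^sup>2 + (y $ i)\<^sup>2" .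
      then have "\<bar>x $ i - y $ i\<bar> * z t $ i * norm (T i g (z t)) \<le> ((x $ i)\<^sup>2 + (y $ i)\<^sup>2) * B"
        using B[OF zseg[OF t]] zi by (intro mult_mono) auto
      then show "norm (((x $ i - y $ i) * z t $ i) *\<^sub>R T i g (z t)) \<le> ((x $ i)\<^sup>2 + (y $ i)\<^sup>2) * B"
        using zi by (simp add: abs_mult)
    qed
    also have "\<dots> = (\<Sum>i\<in>UNIV. (x $ i)\<^sup>2 + (y $ i)\<^sup>2) * B"
      by (rule sum_distrib_right[symmetric])
    also have "\<dots> = B * ((norm x)\<^sup>2 + (norm y)\<^sup>2)"
      by (simp add: norm_power2_vec sum.distrib)
    finally show "onorm (\<lambda>k. k *\<^sub>R frechet_derivative g (at (z t)) (x - y)) \<le> B * ((norm x)\<^sup>2 + (norm y)\<^sup>2)"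
      by (intro onorm_le) (simp add: mult.commute[of "B * _"] mult_left_mono)
  qed auto
  then show ?thesis by (simp add: z_def)
qed

section \<open>Behaviour at the origin\<close>

lemma scaled_tendsto_0_within_orthant:
  assumes "x \<in> orthant"
  shows "filterlim (\<lambda>n. inverse (real (Suc n)) *\<^sub>R x) (at 0 within orthant) sequentially"
  unfolding filterlim_at
proof
  have "(\<lambda>n. inverse (real (Suc n)) *\<^sub>R x) \<longlonglongrightarrow> 0 *\<^sub>R x"
    by (intro tendsto_intros LIMSEQ_inverse_real_of_nat)
  then show "(\<lambda>n. inverse (real (Suc n)) *\<^sub>R x) \<longlonglongrightarrow> 0" by simp
  have "x \<noteq> 0" using assms by (auto simp: orthant_def)
  then show "\<forall>\<^sub>F n in sequentially. inverse (real (Suc n)) *\<^sub>R x \<in> orthant \<and> inverse (real (Suc n)) *\<^sub>R x \<noteq> 0"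
    using scaleR_orthant[OF assms] by (intro always_eventually) auto
qed

lemma at_0_within_orthant_neq_bot: "at 0 within (orthant :: (real ^ 'n) set) \<noteq> bot"
proof
  assume "at 0 within (orthant :: (real ^ 'n) set) = bot"
  then have "filtermap (\<lambda>n. inverse (real (Suc n)) *\<^sub>R (1 :: real ^ 'n)) sequentially \<le> bot"
    using scaled_tendsto_0_within_orthant[OF vec_1_in_orthant] by (metis filterlim_def)
  then show False by (simp add: bot_unique filtermap_bot_iff)
qed

text \<open>The increment estimate between \<open>x\<close> and \<open>x/(n+1)\<close>, as
  \<open>n\<close> grows. The segments stay in the orthant and in the ball of radius
  \<open>||x||\<close>, so \<open>B\<close> may depend on that radius; this is what makes the
  estimate iterable.\<close>

lemma T_bound_limit:
  fixes g :: "real ^ 'n \<Rightarrow> complex"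
  assumes sm: "smooth_on orthant g" and x: "x \<in> orthant"
    and L: "(g \<longlongrightarrow> L) (at 0 within orthant)"
    and B: "\<And>z i. z \<in> orthant \<Longrightarrow> norm z \<le> norm x \<Longrightarrow> norm (T i g z) \<le> B"
  shows "norm (g x - L) \<le> B * (norm x)\<^sup>2"
proof -
  define y where "y = (\<lambda>n. inverse (real (Suc n)) *\<^sub>R x)"
  have y: "filterlim y (at 0 within orthant) sequentially"
    unfolding y_def by (rule scaled_tendsto_0_within_orthant[OF x])
  have yin: "y n \<in> orthant" for n unfolding y_def by (rule scaleR_orthant[OF x]) simp
  have "norm (g x - g (y n)) \<le> B * ((norm x)\<^sup>2 + (norm (y n))\<^sup>2)" for n
  proof (rule T_bound_increment[OF sm x yin B])
    fix z assume z: "z \<in> closed_segment (y n) x"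
    have "norm (y n) \<le> norm x"
      by (auto simp: y_def inverse_le_1_iff intro!: mult_left_le_one_le)
    then have "closed_segment (y n) x \<subseteq> cball 0 (norm x)"
      by (intro closed_segment_subset) auto
    moreover have "closed_segment (y n) x \<subseteq> orthant"
      by (intro closed_segment_subset yin x convex_orthant)
    ultimately show "z \<in> orthant" "norm z \<le> norm x" using z by auto
  qed
  moreover have "(\<lambda>n. norm (g x - g (y n))) \<longlonglongrightarrow> norm (g x - L)"
    using filterlim_compose[OF L y] by (intro tendsto_intros)
  moreover have "y \<longlonglongrightarrow> 0" using y by (simp add: filterlim_at)
  then have "(\<lambda>n. B * ((norm x)\<^sup>2 + (norm (y n))\<^sup>2)) \<longlonglongrightarrow> B * ((norm x)\<^sup>2 + (norm (0 :: real ^ 'n))\<^sup>2)"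
    by (intro tendsto_intros)
  then have "(\<lambda>n. B * ((norm x)\<^sup>2 + (norm (y n))\<^sup>2)) \<longlonglongrightarrow> B * (norm x)\<^sup>2" by simp
  ultimately show ?thesis by (blast intro: LIMSEQ_le)
qed

text \<open>Increments are at most \<open>B * (||x||^2 + ||z||^2)\<close>, so the values along one
  ray form a Cauchy sequence. Letting \<open>z\<close> run along that ray then bounds the distance
  to the limit at every \<open>x\<close>, whatever the direction of approach.\<close>

lemma T_bound_convergent:
  fixes g :: "real ^ 'n \<Rightarrow> complex"
  assumes sm: "smooth_on orthant g" and B: "\<And>z i. z \<in> orthant \<Longrightarrow> norm (T i g z) \<le> B"
  shows "\<exists>L. (g \<longlongrightarrow> L) (at 0 within orthant)"
proof -
  define y where "y = (\<lambda>n. inverse (real (Suc n)) *\<^sub>R (1 :: real ^ 'n))"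
  have yin: "y n \<in> orthant" for n unfolding y_def by (rule scaleR_orthant[OF vec_1_in_orthant]) simp
  have bound: "norm (g x - g z) \<le> B * ((norm x)\<^sup>2 + (norm z)\<^sup>2)" if "x \<in> orthant" "z \<in> orthant" for x z
    using that B closed_segment_subset[OF that(2,1) convex_orthant]
    by (intro T_bound_increment[OF sm]) auto
  have "y \<longlonglongrightarrow> 0"
    using scaled_tendsto_0_within_orthant[OF vec_1_in_orthant] unfolding filterlim_at y_def by blast
  then have "(\<lambda>n. B * (norm (y n))\<^sup>2) \<longlonglongrightarrow> B * (norm (0 :: real ^ 'n))\<^sup>2"
    by (intro tendsto_intros)
  then have lim0: "(\<lambda>n. B * (norm (y n))\<^sup>2) \<longlonglongrightarrow> 0" by simp
  have "Cauchy (\<lambda>n. g (y n))"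
  proof (rule metric_CauchyI)
    fix e :: real assume "e > 0"
    with lim0 obtain M where M: "\<And>n. n \<ge> M \<Longrightarrow> \<bar>B * (norm (y n))\<^sup>2\<bar> < e / 2"
      using LIMSEQ_D[OF lim0, of "e / 2"] by auto
    have "dist (g (y m)) (g (y n)) < e" if "m \<ge> M" "n \<ge> M" for m n
      using bound[OF yin yin, of m n] M[OF that(1)] M[OF that(2)] by (auto simp: dist_norm distrib_left)
    then show "\<exists>M. \<forall>m\<ge>M. \<forall>n\<ge>M. dist (g (y m)) (g (y n)) < e" by blast
  qed
  then obtain L where L: "(\<lambda>n. g (y n)) \<longlonglongrightarrow> L" using Cauchy_convergent convergent_def by blast
  have "norm (g x - L) \<le> B * (norm x)\<^sup>2" if "x \<in> orthant" for x
  proof (rule LIMSEQ_le)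
    show "(\<lambda>n. norm (g x - g (y n))) \<longlonglongrightarrow> norm (g x - L)"
      using L by (intro tendsto_intros)
    show "(\<lambda>n. B * (norm x)\<^sup>2 + B * (norm (y n))\<^sup>2) \<longlonglongrightarrow> B * (norm x)\<^sup>2"
      using tendsto_add[OF tendsto_const lim0] by simp
    show "\<exists>N. \<forall>n\<ge>N. norm (g x - g (y n)) \<le> B * (norm x)\<^sup>2 + B * (norm (y n))\<^sup>2"
      using bound[OF that yin] by (simp add: distrib_left)
  qed
  then have "\<forall>\<^sub>F x in at 0 within orthant. norm (g x - L) \<le> B * (norm x)\<^sup>2"
    by (simp add: eventually_at_filter)
  moreover
  have "((\<lambda>x :: real ^ 'n. B * (norm x)\<^sup>2) \<longlongrightarrow> B * (norm (0 :: real ^ 'n))\<^sup>2) (at 0 within orthant)"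
    by (intro tendsto_intros)
  then have "((\<lambda>x :: real ^ 'n. B * (norm x)\<^sup>2) \<longlongrightarrow> 0) (at 0 within orthant)" by simp
  ultimately have "((\<lambda>x. g x - L) \<longlongrightarrow> 0) (at 0 within orthant)"
    by (rule Lim_null_comparison)
  then show ?thesis using LIM_zero_iff by blast
qed

text \<open>Induction on the number \<open>p\<close> of missing derivatives: the bound for the words
  \<open>i # w\<close> holds on the ball of radius \<open>||x||\<close>, and
  \<open>T_bound_limit\<close> turns it into one for \<open>w\<close> with an extra factor
  \<open>||x||^2\<close>. No factorials are tracked.\<close>

lemma T_word_taylor:
  fixes g :: "real ^ 'n \<Rightarrow> complex"
  assumes sm: "smooth_on orthant g"
    and K: "\<And>w x. length w = Suc N \<Longrightarrow> x \<in> orthant \<Longrightarrow> norm (T_word w g x) \<le> K"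
    and lim: "\<And>w. length w \<le> N \<Longrightarrow> (T_word w g \<longlongrightarrow> 0) (at 0 within orthant)"
    and w: "length w + p = Suc N" and x: "x \<in> orthant"
  shows "norm (T_word w g x) \<le> K * ((norm x)\<^sup>2) ^ p"
  using w x
proof (induction p arbitrary: w x)
  case 0
  then show ?case using K by simp
next
  case (Suc p)
  have K0: "K \<ge> 0"
    using K[of "replicate (Suc N) undefined" 1] vec_1_in_orthant norm_ge_zero order_trans
    by (metis length_replicate)
  have "norm (T_word w g x - 0) \<le> (K * ((norm x)\<^sup>2) ^ p) * (norm x)\<^sup>2"
  proof (rule T_bound_limit[OF smooth_on_T_word[OF sm] Suc.prems(2) lim])
    fix z :: "real ^ 'n" and i assume z: "z \<in> orthant" "norm z \<le> norm x"
    have "norm (T i (T_word w g) z) \<le> K * ((norm z)\<^sup>2) ^ p"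
      using Suc.IH[of "i # w" z] Suc.prems z by simp
    also have "\<dots> \<le> K * ((norm x)\<^sup>2) ^ p"
      using z K0 by (intro mult_left_mono power_mono) auto
    finally show "norm (T i (T_word w g) z) \<le> K * ((norm x)\<^sup>2) ^ p" .
  qed (use Suc.prems in auto)
  then show ?case by (simp add: ac_simps)
qed

section \<open>The space \<open>H_space\<close>\<close>

lemma weighted_add: "weighted \<mu> (\<lambda>x. \<phi> x + \<psi> x) = (\<lambda>x. weighted \<mu> \<phi> x + weighted \<mu> \<psi> x)"
  by (auto simp: weighted_def scaleR_add_right)

lemma weighted_mult: "weighted \<mu> (\<lambda>x. a x * \<phi> x) = (\<lambda>x. a x * weighted \<mu> \<phi> x)"
  by (auto simp: weighted_def)

lemma gamma_fun_eq:
  "gamma_fun \<mu> m k \<phi> x = (1 + (norm x)\<^sup>2) ^ m * norm (T_word (mi_word k) (weighted \<mu> \<phi>) x)"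
  by (simp add: gamma_fun_def Tpow_eq_T_word)

lemma H_spaceI:
  assumes "smooth_on orthant \<phi>" "\<And>x. x \<notin> orthant \<Longrightarrow> \<phi> x = 0"
    and "\<And>m w. \<exists>K. \<forall>x\<in>orthant. (1 + (norm x)\<^sup>2) ^ m * norm (T_word w (weighted \<mu> \<phi>) x) \<le> K"
  shows "\<phi> \<in> H_space \<mu>"
proof -
  have "bdd_above (gamma_fun \<mu> m k \<phi> ` orthant)" for m k
    using assms(3)[of m "mi_word k"] by (auto simp: bdd_above_def gamma_fun_eq)
  then show ?thesis using assms by (simp add: H_space_def)
qed

lemma H_space_smooth: "\<phi> \<in> H_space \<mu> \<Longrightarrow> smooth_on orthant \<phi>"
  by (simp add: H_space_def)

lemma H_space_outside: "\<phi> \<in> H_space \<mu> \<Longrightarrow> x \<notin> orthant \<Longrightarrow> \<phi> x = 0"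
  by (simp add: H_space_def)

lemma H_space_weighted_smooth: "\<phi> \<in> H_space \<mu> \<Longrightarrow> smooth_on orthant (weighted \<mu> \<phi>)"
  by (simp add: H_space_smooth smooth_on_weighted)

lemma H_space_bound:
  fixes \<mu> :: "real ^ 'n::{finite,linorder}"
  assumes "\<phi> \<in> H_space \<mu>"
  obtains K where "K \<ge> 0"
    "\<And>x. x \<in> orthant \<Longrightarrow> (1 + (norm x)\<^sup>2) ^ m * norm (T_word w (weighted \<mu> \<phi>) x) \<le> K"
proof -
  have "bdd_above (gamma_fun \<mu> m (\<chi> i. count (mset w) i) \<phi> ` orthant)"
    using assms by (simp add: H_space_def)
  then obtain K where K: "\<And>x. x \<in> orthant \<Longrightarrow> gamma_fun \<mu> m (\<chi> i. count (mset w) i) \<phi> x \<le> K"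
    by (auto simp: bdd_above_def)
  then have *: "(1 + (norm x)\<^sup>2) ^ m * norm (T_word w (weighted \<mu> \<phi>) x) \<le> K" if "x \<in> orthant" for x
    using K[OF that] T_word_eq_Tpow[OF H_space_weighted_smooth[OF assms] that, of w]
    by (simp add: gamma_fun_def)
  moreover have "K \<ge> 0" using *[OF vec_1_in_orthant] by (rule order_trans[rotated]) simp
  ultimately show ?thesis using that by blast
qed

lemma H_space_add:
  assumes "\<phi> \<in> H_space \<mu>" "\<psi> \<in> H_space \<mu>"
  shows "(\<lambda>x. \<phi> x + \<psi> x) \<in> H_space \<mu>"
proof (rule H_spaceI)
  fix m w
  obtain K1 where K1: "\<And>x. x \<in> orthant \<Longrightarrow> (1 + (norm x)\<^sup>2) ^ m * norm (T_word w (weighted \<mu> \<phi>) x) \<le> K1"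
    using H_space_bound[OF assms(1)] by blast
  obtain K2 where K2: "\<And>x. x \<in> orthant \<Longrightarrow> (1 + (norm x)\<^sup>2) ^ m * norm (T_word w (weighted \<mu> \<psi>) x) \<le> K2"
    using H_space_bound[OF assms(2)] by blast
  have "(1 + (norm x)\<^sup>2) ^ m * norm (T_word w (weighted \<mu> (\<lambda>x. \<phi> x + \<psi> x)) x) \<le> K1 + K2"
    if x: "x \<in> orthant" for x
  proof -
    have "(1 + (norm x)\<^sup>2) ^ m * norm (T_word w (weighted \<mu> \<phi>) x + T_word w (weighted \<mu> \<psi>) x)
      \<le> (1 + (norm x)\<^sup>2) ^ m * (norm (T_word w (weighted \<mu> \<phi>) x) + norm (T_word w (weighted \<mu> \<psi>) x))"
      by (intro mult_left_mono norm_triangle_ineq) simp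
    also have "\<dots> \<le> K1 + K2" using K1[OF x] K2[OF x] by (simp add: distrib_left)
    finally show ?thesis
      using assms x by (simp add: weighted_add T_word_add H_space_weighted_smooth)
  qed
  then show "\<exists>K. \<forall>x\<in>orthant. (1 + (norm x)\<^sup>2) ^ m * norm (T_word w (weighted \<mu> (\<lambda>x. \<phi> x + \<psi> x)) x) \<le> K"
    by blast
qed (use assms in \<open>auto simp: H_space_outside intro: smooth_on_add open_orthant H_space_smooth\<close>)

text \<open>By the Leibniz rule, with the growth weight placed on the factor \<phi> alone, bounded
  \<open>T\<close>-derivatives of the multiplier suffice. This covers constants and cutoffs.\<close>

lemma H_space_mult:
  fixes \<mu> :: "real ^ 'n::{finite,linorder}"
  assumes a: "smooth_on orthant a" and phi: "\<phi> \<in> H_space \<mu>"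
    and bounded: "\<And>w. \<exists>B. \<forall>x\<in>orthant. norm (T_word w a x) \<le> B"
  shows "(\<lambda>x. a x * \<phi> x) \<in> H_space \<mu>"
proof (rule H_spaceI)
  fix m and w :: "'n list"
  let ?u = "weighted \<mu> \<phi>"
  \<comment> \<open>All words arising in the Leibniz rule lie in this finite set, so sums over it
    give bounds common to all splittings.\<close>
  define W where "W = {p :: 'n list. length p \<le> length w}"
  have fin: "finite W"
    unfolding W_def using finite_lists_length_le[of "UNIV :: 'n set" "length w"] by simp
  obtain b where b: "\<And>p x. x \<in> orthant \<Longrightarrow> norm (T_word p a x) \<le> b p"
    using bounded by metis
  have "\<exists>K. \<forall>x\<in>orthant. (1 + (norm x)\<^sup>2) ^ m * norm (T_word q ?u x) \<le> K" for q
    using H_space_bound[OF phi] by metis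
  then obtain K where K: "\<And>q x. x \<in> orthant \<Longrightarrow> (1 + (norm x)\<^sup>2) ^ m * norm (T_word q ?u x) \<le> K q"
    by metis
  have b0: "0 \<le> b p" for p using b[OF vec_1_in_orthant, of p] by (rule order_trans[rotated]) simp
  have K0: "0 \<le> K p" for p using K[OF vec_1_in_orthant, of p] by (rule order_trans[rotated]) simp
  define C where "C = sum b W * sum K W"
  have "(1 + (norm x)\<^sup>2) ^ m * norm (T_word w (weighted \<mu> (\<lambda>x. a x * \<phi> x)) x) \<le> 2 ^ length w * C"
    if x: "x \<in> orthant" for x
  proof -
    have pos: "(1 + (norm x)\<^sup>2) ^ m > 0" by (simp add: add_pos_nonneg)
    have "norm (T_word w (\<lambda>x. a x * ?u x) x) \<le> 2 ^ length w * (C / (1 + (norm x)\<^sup>2) ^ m)"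
    proof (rule T_word_mult_bound[OF a H_space_weighted_smooth[OF phi] x])
      fix p q :: "'n list" assume "length p + length q = length w"
      then have pq: "p \<in> W" "q \<in> W" by (auto simp: W_def)
      have "norm (T_word p a x) * ((1 + (norm x)\<^sup>2) ^ m * norm (T_word q ?u x)) \<le> C"
        unfolding C_def
      proof (rule mult_mono)
        show "norm (T_word p a x) \<le> sum b W"
          using b[OF x, of p] member_le_sum[OF pq(1), of b] fin b0 by fastforce
        show "(1 + (norm x)\<^sup>2) ^ m * norm (T_word q ?u x) \<le> sum K W"
          using K[OF x, of q] member_le_sum[OF pq(2), of K] fin K0 by fastforce
      qed (auto intro: sum_nonneg b0)
      then show "norm (T_word p a x) * norm (T_word q ?u x) \<le> C / (1 + (norm x)\<^sup>2) ^ m"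
        using pos by (simp add: pos_le_divide_eq ac_simps)
    qed
    then show ?thesis unfolding weighted_mult using pos by (simp add: field_simps)
  qed
  then show "\<exists>K. \<forall>x\<in>orthant. (1 + (norm x)\<^sup>2) ^ m * norm (T_word w (weighted \<mu> (\<lambda>x. a x * \<phi> x)) x) \<le> K"
    by blast
qed (use assms in \<open>auto simp: H_space_outside intro: smooth_on_mult open_orthant H_space_smooth\<close>)

lemma T_word_const_bounded:
  assumes "x \<in> orthant" shows "norm (T_word w (\<lambda>_. c) x) \<le> norm c"
proof (cases w rule: rev_cases)
  case (snoc v i)
  \<comment> \<open>Zero is written as \<open>0 * 0\<close> so that \<open>T_word_cmult\<close> can
    pull out a factor 0.\<close>
  have "T_word v (T i (\<lambda>_. c)) x = T_word v (\<lambda>_. 0 * 0) x"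
    using T_const by (intro T_word_cong smooth_on_T smooth_on_const open_orthant assms) auto
  also have "\<dots> = 0"
    using assms by (subst T_word_cmult) (auto intro: smooth_on_const open_orthant)
  finally show ?thesis using snoc by simp
qed simp

lemma H_space_cmult:
  assumes "\<phi> \<in> H_space \<mu>" shows "(\<lambda>x. c * \<phi> x) \<in> H_space \<mu>"
proof (rule H_space_mult[OF smooth_on_const[OF open_orthant] assms])
  show "\<exists>B. \<forall>x\<in>orthant. norm (T_word w (\<lambda>_. c) x) \<le> B" for w
    using T_word_const_bounded by blast
qed

lemma H_space_zero: "(\<lambda>_. 0) \<in> H_space \<mu>"
proof (rule H_spaceI)
  show "\<exists>K. \<forall>x\<in>orthant. (1 + (norm x)\<^sup>2) ^ m * norm (T_word w (weighted \<mu> (\<lambda>_. 0)) x) \<le> K" for m w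
    using T_word_const_bounded[of _ w 0] by (auto simp: weighted_def[abs_def])
qed (auto simp: smooth_on_const open_orthant)

text \<open>\<open>Lim\<close> denotes the actual limit once one exists; existence follows since the
  seminorms with \<open>m = 0\<close>, one order higher, bound all \<open>T i\<close> of the
  function.\<close>

lemma H_space_Lim:
  assumes "\<phi> \<in> H_space \<mu>"
  shows "(T_word w (weighted \<mu> \<phi>) \<longlongrightarrow> Lim (at 0 within orthant) (T_word w (weighted \<mu> \<phi>))) (at 0 within orthant)"
proof -
  have "\<exists>K. \<forall>x\<in>orthant. norm (T i (T_word w (weighted \<mu> \<phi>)) x) \<le> K" for i
  proof -
    obtain K where "\<And>x. x \<in> orthant \<Longrightarrow> (1 + (norm x)\<^sup>2) ^ 0 * norm (T_word (i # w) (weighted \<mu> \<phi>) x) \<le> K"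
      using H_space_bound[OF assms] by blast
    then show ?thesis by auto
  qed
  then obtain K where K: "\<And>i x. x \<in> orthant \<Longrightarrow> norm (T i (T_word w (weighted \<mu> \<phi>)) x) \<le> K i"
    by metis
  then have "norm (T i (T_word w (weighted \<mu> \<phi>)) x) \<le> (\<Sum>i\<in>UNIV. \<bar>K i\<bar>)" if "x \<in> orthant" for i x
    using K[OF that, of i] member_le_sum[of i UNIV "\<lambda>i. \<bar>K i\<bar>"] by simp
  then obtain L where L: "(T_word w (weighted \<mu> \<phi>) \<longlongrightarrow> L) (at 0 within orthant)"
    using T_bound_convergent[OF smooth_on_T_word[OF H_space_weighted_smooth[OF assms]]] by blast
  show ?thesis using L unfolding tendsto_Lim[OF at_0_within_orthant_neq_bot L] .
qed

section \<open>Linearity and kernels of the functionals \<open>T_delta\<close>\<close>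

lemma T_delta_add:
  assumes "\<phi> \<in> H_space \<mu>" "\<psi> \<in> H_space \<mu>"
  shows "T_delta \<mu> k (\<lambda>x. \<phi> x + \<psi> x) = T_delta \<mu> k \<phi> + T_delta \<mu> k \<psi>"
proof -
  let ?L = "\<lambda>\<phi>. Lim (at 0 within orthant) (T_word (mi_word k) (weighted \<mu> \<phi>))"
  have "(T_word (mi_word k) (weighted \<mu> (\<lambda>x. \<phi> x + \<psi> x)) \<longlongrightarrow> ?L \<phi> + ?L \<psi>) (at 0 within orthant)"
  proof (rule Lim_transform_eventually[OF tendsto_add[OF H_space_Lim[OF assms(1)] H_space_Lim[OF assms(2)]]])
    show "\<forall>\<^sub>F x in at 0 within orthant. T_word (mi_word k) (weighted \<mu> \<phi>) x + T_word (mi_word k) (weighted \<mu> \<psi>) x =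
        T_word (mi_word k) (weighted \<mu> (\<lambda>x. \<phi> x + \<psi> x)) x"
      using assms by (simp add: eventually_at_filter weighted_add T_word_add H_space_weighted_smooth)
  qed
  then have "?L (\<lambda>x. \<phi> x + \<psi> x) = ?L \<phi> + ?L \<psi>"
    by (rule tendsto_Lim[OF at_0_within_orthant_neq_bot])
  then show ?thesis by (simp add: T_delta_def Tpow_eq_T_word scaleR_add_right)
qed

lemma T_delta_cmult:
  assumes "\<phi> \<in> H_space \<mu>"
  shows "T_delta \<mu> k (\<lambda>x. c * \<phi> x) = c * T_delta \<mu> k \<phi>"
proof -
  let ?L = "\<lambda>\<phi>. Lim (at 0 within orthant) (T_word (mi_word k) (weighted \<mu> \<phi>))"
  have "(T_word (mi_word k) (weighted \<mu> (\<lambda>x. c * \<phi> x)) \<longlongrightarrow> c * ?L \<phi>) (at 0 within orthant)"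
  proof (rule Lim_transform_eventually[OF tendsto_mult[OF tendsto_const H_space_Lim[OF assms(1)]]])
    show "\<forall>\<^sub>F x in at 0 within orthant. c * T_word (mi_word k) (weighted \<mu> \<phi>) x =
        T_word (mi_word k) (weighted \<mu> (\<lambda>x. c * \<phi> x)) x"
      using assms by (simp add: eventually_at_filter weighted_mult T_word_cmult H_space_weighted_smooth)
  qed
  then have "?L (\<lambda>x. c * \<phi> x) = c * ?L \<phi>"
    by (rule tendsto_Lim[OF at_0_within_orthant_neq_bot])
  then show ?thesis by (simp add: T_delta_def Tpow_eq_T_word)
qed

text \<open>The lower bound on \<mu> makes the arguments of \<open>Gamma\<close> positive. That the
  constant is nonzero allows \<open>T_delta \<mu> k \<phi> = 0\<close> to be read as the vanishing
  of a limit.\<close>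

lemma C_const_pos:
  assumes "\<forall>i. - 1 / 2 \<le> \<mu> $ i" shows "C_const \<mu> > 0"
  unfolding C_const_def
proof (rule prod_pos)
  fix i
  have "\<mu> $ i + 1 > 0" using assms[rule_format, of i] by simp
  then show "0 < 2 powr (\<mu> $ i) * Gamma (\<mu> $ i + 1)" by (simp add: Gamma_real_pos)
qed

lemma T_delta_eq_0_imp_tendsto:
  assumes "\<forall>i. - 1 / 2 \<le> \<mu> $ i" "\<phi> \<in> H_space \<mu>"
    and "\<And>k. mi_abs k \<le> N \<Longrightarrow> T_delta \<mu> k \<phi> = 0" and "length w \<le> N"
  shows "(T_word w (weighted \<mu> \<phi>) \<longlongrightarrow> 0) (at 0 within orthant)"
proof -
  let ?k = "\<chi> i. count (mset w) i"
  have "Lim (at 0 within orthant) (T_word (mi_word ?k) (weighted \<mu> \<phi>)) = 0"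
    using assms(3)[of ?k] assms(4) C_const_pos[OF assms(1)]
    by (simp add: mi_abs_count T_delta_def Tpow_eq_T_word)
  then have "(T_word (mi_word ?k) (weighted \<mu> \<phi>) \<longlongrightarrow> 0) (at 0 within orthant)"
    using H_space_Lim[OF assms(2), of "mi_word ?k"] by simp
  moreover have "T_word (mi_word ?k) (weighted \<mu> \<phi>) x = T_word w (weighted \<mu> \<phi>) x" if "x \<in> orthant" for x
    using T_word_eq_Tpow[OF H_space_weighted_smooth[OF assms(2)] that, of w, unfolded Tpow_eq_T_word] ..
  then have "\<forall>\<^sub>F x in at 0 within orthant. T_word (mi_word ?k) (weighted \<mu> \<phi>) x = T_word w (weighted \<mu> \<phi>) x"
    by (simp add: eventually_at_filter)
  ultimately show ?thesis by (rule Lim_transform_eventually)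
qed

section \<open>Localisation near the origin\<close>

text \<open>The index \<open>n\<close> keeps the family closed under every \<open>T i\<close> up to
  the scalar \<open>2/d\<close>; the cutoff itself is \<open>n = 0\<close>.\<close>

definition ball_cutoff :: "nat \<Rightarrow> real \<Rightarrow> real ^ 'n \<Rightarrow> complex" where
  "ball_cutoff n d x = complex_of_real ((deriv ^^ n) cutoff ((norm x)\<^sup>2 / d))"

lemma smooth_on_ball_cutoff:
  fixes S :: "(real ^ 'n) set"
  assumes "open S" shows "smooth_on S (ball_cutoff n d)"
proof -
  have "smooth_on S (\<lambda>x. (\<Sum>i\<in>UNIV. x $ i * x $ i) * (1 / d))"
    by (intro smooth_on_mult smooth_on_sum smooth_on_const assms
        smooth_on_linear[OF assms bounded_linear_vec_nth])
  then have "smooth_on S (\<lambda>x. (deriv ^^ n) cutoff ((\<Sum>i\<in>UNIV. x $ i * x $ i) * (1 / d)))"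
    by (intro smooth_on_compose_real[OF assms, of UNIV "\<lambda>n. (deriv ^^ n) cutoff"])
      (auto intro: smooth_on_iterated_deriv(2)[OF smooth_on_cutoff, simplified])
  then have "smooth_on S (\<lambda>x. (deriv ^^ n) cutoff ((\<Sum>i\<in>UNIV. x $ i * x $ i) * (1 / d)) *\<^sub>R (1 :: complex))"
    by (intro smooth_on_scaleR smooth_on_const assms)
  then show ?thesis
    unfolding ball_cutoff_def[abs_def] norm_power2_vec of_real_def by (simp add: power2_eq_square)
qed

text \<open>The gradient of \<open>||x||^2 / d\<close> is \<open>2 x / d\<close>, and its
  \<open>i\<close>-th component loses \<open>x_i\<close> to the factor \<open>1/x_i\<close> in
  \<open>T i\<close>.\<close>

lemma T_ball_cutoff:
  assumes "x \<in> orthant"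
  shows "T i (ball_cutoff n d) x = complex_of_real (2 / d) * ball_cutoff (Suc n) d x"
proof -
  let ?h = "\<lambda>n. (deriv ^^ n) cutoff"
  have "((\<lambda>y. (norm y)\<^sup>2 / d) has_derivative (\<lambda>v. 2 * (x \<bullet> v) / d)) (at x)"
    unfolding power2_norm_eq_inner divide_inverse
    by (auto intro!: derivative_eq_intros simp: inner_commute)
  moreover have "(?h n has_derivative (*) (?h (Suc n) ((norm x)\<^sup>2 / d))) (at ((norm x)\<^sup>2 / d))"
    using smooth_on_iterated_deriv(2)[OF smooth_on_cutoff] by (simp add: has_field_derivative_def)
  ultimately have "((\<lambda>y. ?h n ((norm y)\<^sup>2 / d)) has_derivative
      (\<lambda>v. ?h (Suc n) ((norm x)\<^sup>2 / d) * (2 * (x \<bullet> v) / d))) (at x)"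
    by (rule has_derivative_compose)
  then have "(ball_cutoff n d has_derivative
      (\<lambda>v. complex_of_real (?h (Suc n) ((norm x)\<^sup>2 / d) * (2 * (x \<bullet> v) / d)))) (at x)"
    unfolding ball_cutoff_def[abs_def]
    by (rule bounded_linear.has_derivative[OF bounded_linear_of_real])
  from T_has_derivative_eq[OF smooth_on_ball_cutoff[OF open_orthant] assms this, of i]
  show ?thesis
    using orthant_nth[OF assms, of i]
    by (simp add: ball_cutoff_def inner_axis scaleR_conv_of_real field_simps)
qed

lemma T_word_ball_cutoff:
  assumes "x \<in> orthant"
  shows "T_word w (ball_cutoff 0 d) x = complex_of_real (2 / d) ^ length w * ball_cutoff (length w) d x"
  using assms
proof (induction w arbitrary: x)
  case (Cons i w)
  have "T i (T_word w (ball_cutoff 0 d)) x =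
      T i (\<lambda>x. complex_of_real (2 / d) ^ length w * ball_cutoff (length w) d x) x"
    by (rule T_cong[OF smooth_on_T_word[OF smooth_on_ball_cutoff[OF open_orthant]] Cons.IH Cons.prems])
  then show ?case
    using Cons.prems
    by (simp add: T_mult T_const T_ball_cutoff smooth_on_const smooth_on_ball_cutoff open_orthant)
qed simp

lemma ball_cutoff_bounded:
  obtains B where "B \<ge> 0" "\<And>d (x :: real ^ 'n). d > 0 \<Longrightarrow> norm (ball_cutoff n d x) \<le> B"
proof -
  obtain B where "B \<ge> 0" "\<And>t. t \<ge> 0 \<Longrightarrow> \<bar>(deriv ^^ n) cutoff t\<bar> \<le> B"
    using cutoff_deriv_bounded by blast
  then show ?thesis using that by (simp add: ball_cutoff_def)
qed

lemma ball_cutoff_eq_0: "0 < d \<Longrightarrow> d < (norm x)\<^sup>2 \<Longrightarrow> ball_cutoff n d x = 0"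
  by (simp add: ball_cutoff_def cutoff_deriv_eq_0)

lemma ball_cutoff_eq_1: "0 < d \<Longrightarrow> (norm x)\<^sup>2 \<le> d / 2 \<Longrightarrow> ball_cutoff 0 d x = 1"
  by (simp add: ball_cutoff_def cutoff_eq_1 field_simps)

lemma H_space_ball_cutoff:
  assumes "\<phi> \<in> H_space \<mu>" "d > 0"
  shows "(\<lambda>x. ball_cutoff 0 d x * \<phi> x) \<in> H_space \<mu>"
proof (rule H_space_mult[OF smooth_on_ball_cutoff[OF open_orthant] assms(1)])
  fix w :: "'a list"
  obtain B where B: "\<And>x :: (real, 'a) vec. norm (ball_cutoff (length w) d x) \<le> B"
    using ball_cutoff_bounded assms(2) by metis
  have "norm (T_word w (ball_cutoff 0 d) x) \<le> (2 / d) ^ length w * B" if "x \<in> orthant" for x :: "(real, 'a) vec"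
    using that B[of x] assms(2)
    by (simp add: T_word_ball_cutoff norm_mult norm_power norm_divide mult_left_mono)
  then show "\<exists>B. \<forall>x\<in>orthant. norm (T_word w (ball_cutoff 0 d) x) \<le> B" by blast
qed

text \<open>Each \<open>T\<close>-derivative of the cutoff costs a factor \<open>1/d\<close>, while on the support \<open>\<parallel>x\<parallel>\<^sup>2 \<le> d\<close> the Taylor
  bound gains a factor \<open>d\<close> for each derivative below the order \<open>N + 1\<close>; one factor \<open>d\<close> is left over.\<close>

lemma ball_cutoff_mult_small:
  fixes \<mu> :: "real ^ 'n::{finite,linorder}"
  assumes phi: "\<phi> \<in> H_space \<mu>"
    and lim: "\<And>w. length w \<le> N \<Longrightarrow> (T_word w (weighted \<mu> \<phi>) \<longlongrightarrow> 0) (at 0 within orthant)"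
    and w: "length w \<le> N"
  shows "\<exists>C\<ge>0. \<forall>d x. 0 < d \<longrightarrow> d \<le> 1 \<longrightarrow> x \<in> orthant \<longrightarrow>
    (1 + (norm x)\<^sup>2) ^ m * norm (T_word w (weighted \<mu> (\<lambda>x. ball_cutoff 0 d x * \<phi> x)) x) \<le> C * d"
proof -
  let ?u = "weighted \<mu> \<phi>"
  note sm = H_space_weighted_smooth[OF phi]
  have "\<exists>K\<ge>0. \<forall>x\<in>orthant. norm (T_word q ?u x) \<le> K" for q
    using H_space_bound[OF phi, of 0 q] by (metis mult_1 power_0)
  then obtain k where k0: "\<And>q. 0 \<le> k q" and k: "\<And>q x. x \<in> orthant \<Longrightarrow> norm (T_word q ?u x) \<le> k q"
    by metis
  \<comment> \<open>A sum over the finitely many words of length \<open>N + 1\<close>, hence one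
    constant for all of them.\<close>
  define K where "K = sum k {q :: 'n list. set q \<subseteq> UNIV \<and> length q = Suc N}"
  have K: "norm (T_word q ?u x) \<le> K" if "length q = Suc N" "x \<in> orthant" for q x
    unfolding K_def
    by (rule order_trans[OF k[OF that(2)]], rule member_le_sum)
      (use that k0 finite_lists_length_eq[of "UNIV :: 'n set" "Suc N"] in auto)
  have K0: "K \<ge> 0" unfolding K_def by (intro sum_nonneg k0)
  have "\<exists>B\<ge>0. \<forall>d>0. \<forall>x :: (real, 'n) vec. norm (ball_cutoff n d x) \<le> B" for n
    using ball_cutoff_bounded by metis
  then obtain b where b0: "\<And>n. 0 \<le> b n"
    and b: "\<And>n d x. d > 0 \<Longrightarrow> norm (ball_cutoff n d (x :: (real, 'n) vec)) \<le> b n"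
    by metis
  define B where "B = sum b {..N}"
  have B: "norm (ball_cutoff n d x) \<le> B" if "n \<le> N" "d > 0" for n d and x :: "(real, 'n) vec"
    using b[OF that(2), of n x] member_le_sum[of n "{..N}" b] b0 that(1) by (fastforce simp: B_def)
  have B0: "B \<ge> 0" unfolding B_def by (intro sum_nonneg b0)
  define M where "M = 2 ^ N * B * K"
  have M0: "M \<ge> 0" using B0 K0 by (simp add: M_def)
  have main: "(1 + (norm x)\<^sup>2) ^ m * norm (T_word w (weighted \<mu> (\<lambda>x. ball_cutoff 0 d x * \<phi> x)) x)
      \<le> 2 ^ m * 2 ^ length w * M * d"
    if d: "0 < d" "d \<le> 1" and x: "x \<in> orthant" for d x
  proof (cases "(norm x)\<^sup>2 \<le> d")
    case True
    have "norm (T_word w (\<lambda>x. ball_cutoff 0 d x * ?u x) x) \<le> 2 ^ length w * (M * d)"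
    proof (rule T_word_mult_bound[OF smooth_on_ball_cutoff[OF open_orthant] sm x])
      fix p q :: "'n list" assume pq: "length p + length q = length w"
      \<comment> \<open>The powers of \<open>d\<close> combine to exponent
        \<open>(N + 1 - |q|) - |p| = r + 1\<close>: \<open>d^r\<close> is at most 1, and the
        remaining \<open>d\<close> is the gain.\<close>
      define r where "r = N - length p - length q"
      have r: "Suc N - length q = length p + Suc r" using pq w by (simp add: r_def)
      have 1: "norm (T_word p (ball_cutoff 0 d) x) \<le> (2 / d) ^ length p * B"
        using B[OF _ d(1), of "length p" x] pq w d
        by (simp add: T_word_ball_cutoff x norm_mult norm_power norm_divide mult_left_mono)
      have "norm (T_word q ?u x) \<le> K * ((norm x)\<^sup>2) ^ (Suc N - length q)"
        using pq w by (intro T_word_taylor[OF sm K lim _ x]) auto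
      also have "\<dots> \<le> K * d ^ (Suc N - length q)"
        using True K0 by (intro mult_left_mono power_mono) auto
      finally have 2: "norm (T_word q ?u x) \<le> K * d ^ (Suc N - length q)" .
      have "norm (T_word p (ball_cutoff 0 d) x) * norm (T_word q ?u x)
          \<le> ((2 / d) ^ length p * B) * (K * d ^ (Suc N - length q))"
        using 1 2 d B0 by (intro mult_mono) auto
      also have "\<dots> = 2 ^ length p * B * K * d ^ r * d"
        using d unfolding r by (simp add: power_add power_divide field_simps)
      also have "\<dots> \<le> 2 ^ N * B * K * 1 * d"
        using d B0 K0 pq w
        by (intro mult_right_mono mult_mono power_increasing power_le_one) auto
      finally show "norm (T_word p (ball_cutoff 0 d) x) * norm (T_word q ?u x) \<le> M * d"
        by (simp add: M_def)
    qed
    moreover have "(1 + (norm x)\<^sup>2) ^ m \<le> 2 ^ m"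
      using True d by (intro power_mono) auto
    ultimately have "(1 + (norm x)\<^sup>2) ^ m * norm (T_word w (\<lambda>x. ball_cutoff 0 d x * ?u x) x)
        \<le> 2 ^ m * (2 ^ length w * (M * d))"
      by (intro mult_mono) auto
    then show ?thesis unfolding weighted_mult by (simp add: mult.assoc)
  next
    case False
    \<comment> \<open>Outside the ball every derivative of the cutoff vanishes, so each term of the
      Leibniz rule is bounded by 0.\<close>
    have "norm (T_word w (\<lambda>x. ball_cutoff 0 d x * ?u x) x) \<le> 2 ^ length w * 0"
      using False d
      by (intro T_word_mult_bound smooth_on_ball_cutoff open_orthant sm x)
        (simp add: T_word_ball_cutoff x ball_cutoff_eq_0)
    then show ?thesis unfolding weighted_mult using M0 d by simp
  qed
  then show ?thesis
    using M0 by (intro exI[of _ "2 ^ m * 2 ^ length w * M"]) simp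
qed

section \<open>Functionals supported at the origin\<close>

lemma gamma_seminorm_le:
  assumes "\<And>x. x \<in> orthant \<Longrightarrow> gamma_fun \<mu> m k \<phi> x \<le> K"
  shows "gamma_seminorm \<mu> m k \<phi> \<le> K"
  unfolding gamma_seminorm_def using assms vec_1_in_orthant by (intro cSUP_least) auto

lemma gamma_fun_le_seminorm:
  assumes "\<phi> \<in> H_space \<mu>" "x \<in> orthant"
  shows "gamma_fun \<mu> m k \<phi> x \<le> gamma_seminorm \<mu> m k \<phi>"
  unfolding gamma_seminorm_def using assms by (intro cSUP_upper) (auto simp: H_space_def)

lemma gamma_seminorm_add:
  assumes "\<phi> \<in> H_space \<mu>" "\<psi> \<in> H_space \<mu>"
  shows "gamma_seminorm \<mu> m k (\<lambda>x. \<phi> x + \<psi> x) \<le> gamma_seminorm \<mu> m k \<phi> + gamma_seminorm \<mu> m k \<psi>"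
proof (rule gamma_seminorm_le)
  fix x :: "(real, 'a) vec" assume x: "x \<in> orthant"
  have "gamma_fun \<mu> m k (\<lambda>x. \<phi> x + \<psi> x) x \<le> gamma_fun \<mu> m k \<phi> x + gamma_fun \<mu> m k \<psi> x"
    using assms x unfolding gamma_fun_eq weighted_add distrib_left[symmetric]
    by (simp add: T_word_add H_space_weighted_smooth norm_triangle_ineq mult_left_mono)
  then show "gamma_fun \<mu> m k (\<lambda>x. \<phi> x + \<psi> x) x \<le> gamma_seminorm \<mu> m k \<phi> + gamma_seminorm \<mu> m k \<psi>"
    using gamma_fun_le_seminorm[OF assms(1) x, of m k] gamma_fun_le_seminorm[OF assms(2) x, of m k] by simp
qed

text \<open>Induction over the generation of the topology: intersections unite the finite sets of
  seminorms and take the smaller radius, unions inherit from one member, and a generating set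
  centred elsewhere is recentred at 0 by the triangle inequality.\<close>

lemma H_topology_nhd_0:
  assumes "openin (H_topology \<mu>) U" "(\<lambda>_. 0) \<in> U"
  shows "\<exists>F r. finite F \<and> r > 0 \<and>
    (\<forall>\<psi>\<in>H_space \<mu>. (\<forall>(m, k)\<in>F. gamma_seminorm \<mu> m k \<psi> < r) \<longrightarrow> \<psi> \<in> U)"
proof -
  let ?P = "\<lambda>U F r. \<forall>\<psi>\<in>H_space \<mu>. (\<forall>(m, k)\<in>F. gamma_seminorm \<mu> m k \<psi> < r) \<longrightarrow> \<psi> \<in> U"
  let ?S = "{{\<psi> \<in> H_space \<mu>. gamma_seminorm \<mu> m k (\<lambda>x. \<psi> x - \<phi> x) < r} | \<phi> m k r. \<phi> \<in> H_space \<mu> \<and> 0 < r}"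
  have "generate_topology_on ?S U"
    using assms(1) by (simp add: H_topology_def openin_topology_generated_by_iff)
  then show ?thesis
    using assms(2)
  proof (induction rule: generate_topology_on.induct)
    case (Int a b)
    then obtain F1 r1 F2 r2 where "finite F1" "r1 > 0" "?P a F1 r1" "finite F2" "r2 > 0" "?P b F2 r2"
      by blast
    then have "finite (F1 \<union> F2) \<and> min r1 r2 > 0 \<and> ?P (a \<inter> b) (F1 \<union> F2) (min r1 r2)"
      by fastforce
    then show ?case by blast
  next
    case (UN K)
    then obtain k where "k \<in> K" "(\<lambda>_. 0) \<in> k" by blast
    with UN.IH obtain F r where "finite F" "r > 0" "?P k F r" by blast
    then have "?P (\<Union>K) F r" using \<open>k \<in> K\<close> by blast
    then show ?case using \<open>finite F\<close> \<open>r > 0\<close> by blast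
  next
    case (Basis s)
    then obtain \<phi> m k r where s: "s = {\<psi> \<in> H_space \<mu>. gamma_seminorm \<mu> m k (\<lambda>x. \<psi> x - \<phi> x) < r}"
      and phi: "\<phi> \<in> H_space \<mu>" by blast
    have phi': "(\<lambda>x. - 1 * \<phi> x) \<in> H_space \<mu>" by (rule H_space_cmult[OF phi])
    \<comment> \<open>The distance from 0 to the centre in this seminorm. It is below
      \<open>r\<close> since 0 lies in \<open>s\<close>, so the radius \<open>r - g\<close> is
      available around 0.\<close>
    define g where "g = gamma_seminorm \<mu> m k (\<lambda>x. - 1 * \<phi> x)"
    have g: "g < r" using Basis(2) by (simp add: s g_def)
    have "\<psi> \<in> s" if psi: "\<psi> \<in> H_space \<mu>" "gamma_seminorm \<mu> m k \<psi> < r - g" for \<psi>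
      using gamma_seminorm_add[OF psi(1) phi', of m k] psi by (simp add: s g_def)
    then have "finite {(m, k)} \<and> r - g > 0 \<and> ?P s {(m, k)} (r - g)" using g by simp
    then show ?case by blast
  qed simp
qed

text \<open>Induction on the number of functionals with \<open>V\<close> arbitrary: on the kernel of
  \<open>L i\<close> the functional is already a combination of the others, and a single vector
  outside this kernel determines the coefficient of \<open>L i\<close>.\<close>

lemma linear_functional_in_span:
  fixes L :: "'i \<Rightarrow> ('a \<Rightarrow> complex) \<Rightarrow> complex"
  assumes "finite I"
    and "\<And>\<phi> \<psi>. \<phi> \<in> V \<Longrightarrow> \<psi> \<in> V \<Longrightarrow> (\<lambda>x. \<phi> x + \<psi> x) \<in> V"
    and "\<And>c \<phi>. \<phi> \<in> V \<Longrightarrow> (\<lambda>x. c * \<phi> x) \<in> V"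
    and "\<And>i \<phi> \<psi>. i \<in> I \<Longrightarrow> \<phi> \<in> V \<Longrightarrow> \<psi> \<in> V \<Longrightarrow> L i (\<lambda>x. \<phi> x + \<psi> x) = L i \<phi> + L i \<psi>"
    and "\<And>i c \<phi>. i \<in> I \<Longrightarrow> \<phi> \<in> V \<Longrightarrow> L i (\<lambda>x. c * \<phi> x) = c * L i \<phi>"
    and "\<And>\<phi> \<psi>. \<phi> \<in> V \<Longrightarrow> \<psi> \<in> V \<Longrightarrow> f (\<lambda>x. \<phi> x + \<psi> x) = f \<phi> + f \<psi>"
    and "\<And>c \<phi>. \<phi> \<in> V \<Longrightarrow> f (\<lambda>x. c * \<phi> x) = c * f \<phi>"
    and "\<And>\<phi>. \<phi> \<in> V \<Longrightarrow> (\<And>i. i \<in> I \<Longrightarrow> L i \<phi> = 0) \<Longrightarrow> f \<phi> = 0"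
  shows "\<exists>c. \<forall>\<phi>\<in>V. f \<phi> = (\<Sum>i\<in>I. c i * L i \<phi>)"
  using assms
proof (induction I arbitrary: V)
  case empty
  then show ?case by simp
next
  case (insert i I)
  note add = insert.prems(1) and scale = insert.prems(2) and L_add = insert.prems(3)
    and L_scale = insert.prems(4) and f_add = insert.prems(5) and f_scale = insert.prems(6)
    and ker = insert.prems(7)
  have "\<exists>c. \<forall>\<phi>\<in>{\<phi> \<in> V. L i \<phi> = 0}. f \<phi> = (\<Sum>j\<in>I. c j * L j \<phi>)"
    by (rule insert.IH) (auto intro: add scale ker simp: L_add L_scale f_add f_scale)
  then obtain c where c: "\<And>\<phi>. \<phi> \<in> V \<Longrightarrow> L i \<phi> = 0 \<Longrightarrow> f \<phi> = (\<Sum>j\<in>I. c j * L j \<phi>)"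
    by auto
  show ?case
  proof (cases "\<exists>\<phi>\<in>V. L i \<phi> \<noteq> 0")
    case False
    \<comment> \<open>Here \<open>L i\<close> vanishes on all of \<open>V\<close>, so any value of
      \<open>c i\<close> will do.\<close>
    then have "\<forall>\<phi>\<in>V. f \<phi> = (\<Sum>j\<in>insert i I. c j * L j \<phi>)"
      using c insert.hyps by simp
    then show ?thesis by blast
  next
    case True
    then obtain \<theta> where chi: "\<theta> \<in> V" "L i \<theta> \<noteq> 0" by blast
    define b where "b = (f \<theta> - (\<Sum>j\<in>I. c j * L j \<theta>)) / L i \<theta>"
    have "f \<phi> = (\<Sum>j\<in>insert i I. (c(i := b)) j * L j \<phi>)" if phi: "\<phi> \<in> V" for \<phi>
    proof -
      \<comment> \<open>Chosen so that \<phi> plus \<open>a\<close> times \<theta> lies in the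
        kernel of \<open>L i\<close>.\<close>
      define a where "a = - (L i \<phi> / L i \<theta>)"
      have a\<theta>: "(\<lambda>x. a * \<theta> x) \<in> V" by (rule scale[OF chi(1)])
      have L: "L j (\<lambda>x. \<phi> x + a * \<theta> x) = L j \<phi> + a * L j \<theta>" if "j \<in> insert i I" for j
        using that L_add[OF that phi a\<theta>] L_scale[OF that chi(1)] by simp
      have "f \<phi> + a * f \<theta> = f (\<lambda>x. \<phi> x + a * \<theta> x)"
        using f_add[OF phi a\<theta>] f_scale[OF chi(1)] by simp
      also have "\<dots> = (\<Sum>j\<in>I. c j * L j (\<lambda>x. \<phi> x + a * \<theta> x))"
        using chi L[of i] by (intro c add phi a\<theta>) (simp add: a_def)
      also have "\<dots> = (\<Sum>j\<in>I. c j * L j \<phi> + a * (c j * L j \<theta>))"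
        by (intro sum.cong) (auto simp: L algebra_simps)
      also have "\<dots> = (\<Sum>j\<in>I. c j * L j \<phi>) + a * (\<Sum>j\<in>I. c j * L j \<theta>)"
        by (simp add: sum.distrib sum_distrib_left)
      finally have "f \<phi> = (\<Sum>j\<in>I. c j * L j \<phi>) - a * (f \<theta> - (\<Sum>j\<in>I. c j * L j \<theta>))"
        by (simp add: algebra_simps)
      also have "a * (f \<theta> - (\<Sum>j\<in>I. c j * L j \<theta>)) = - (b * L i \<phi>)"
        by (simp add: a_def b_def)
      also have "(\<Sum>j\<in>I. c j * L j \<phi>) = (\<Sum>j\<in>I. (c(i := b)) j * L j \<phi>)"
        using insert.hyps by (intro sum.cong) auto
      finally show ?thesis using insert.hyps by simp
    qed
    then show ?thesis by blast
  qed
qed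

lemma H_dual_eq_0_of_T_delta_eq_0:
  fixes \<mu> :: "real ^ 'n::{finite,linorder}"
  assumes mu: "\<forall>i. - 1/2 \<le> \<mu> $ i"
    and f: "f \<in> H_dual \<mu>"
    and supp: "\<forall>\<phi>\<in>H_space \<mu>. (\<exists>a>0. supp \<phi> \<subseteq> {x \<in> orthant. a \<le> norm x}) \<longrightarrow> f \<phi> = 0"
  obtains N where "\<And>\<phi>. \<phi> \<in> H_space \<mu> \<Longrightarrow> (\<And>k. mi_abs k \<le> N \<Longrightarrow> T_delta \<mu> k \<phi> = 0) \<Longrightarrow> f \<phi> = 0"
proof -
  have f_add: "f (\<lambda>x. \<phi> x + \<psi> x) = f \<phi> + f \<psi>" if "\<phi> \<in> H_space \<mu>" "\<psi> \<in> H_space \<mu>" for \<phi> \<psi>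
    using f that by (simp add: H_dual_def)
  have f_scale: "f (\<lambda>x. c * \<phi> x) = c * f \<phi>" if "\<phi> \<in> H_space \<mu>" for c \<phi>
    using f that by (simp add: H_dual_def)
  define U where "U = {\<psi> \<in> topspace (H_topology \<mu>). f \<psi> \<in> ball 0 1}"
  have "continuous_map (H_topology \<mu>) euclidean f"
    using f by (simp add: H_dual_def)
  then have "openin (H_topology \<mu>) U"
    unfolding U_def by (rule openin_continuous_map_preimage) simp
  moreover have "(\<lambda>_. 0) \<in> U"
  proof -
    \<comment> \<open>The space underlying a generated topology is the union of its generating sets,
      so 0 must be exhibited in one of them.\<close>
    have "gamma_seminorm \<mu> 0 0 (\<lambda>x. 0) \<le> 0"
      by (rule gamma_seminorm_le)
        (use T_word_const_bounded[of _ "mi_word 0" 0] in \<open>auto simp: gamma_fun_eq weighted_def[abs_def]\<close>)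
    then have "(\<lambda>_. 0) \<in> {\<psi> \<in> H_space \<mu>. gamma_seminorm \<mu> 0 0 (\<lambda>x. \<psi> x - 0) < 1}"
      by (simp add: H_space_zero)
    then have "(\<lambda>_. 0) \<in> topspace (H_topology \<mu>)"
      unfolding H_topology_def topology_generated_by_topspace
      by (rule UnionI[rotated], intro CollectI exI[of _ "\<lambda>_. 0"] exI[of _ 0] exI[of _ 1])
        (simp add: H_space_zero)
    moreover have "f (\<lambda>_. 0) = 0" using f_scale[OF H_space_zero, of 0] by simp
    ultimately show ?thesis by (simp add: U_def)
  qed
  ultimately obtain F r where F: "finite F" and r: "r > 0"
    and FU: "\<forall>\<psi>\<in>H_space \<mu>. (\<forall>(m, k)\<in>F. gamma_seminorm \<mu> m k \<psi> < r) \<longrightarrow> \<psi> \<in> U"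
    using H_topology_nhd_0[of \<mu> U] by blast
  have nhd: "norm (f \<psi>) < 1"
    if "\<psi> \<in> H_space \<mu>" "\<And>m k. (m, k) \<in> F \<Longrightarrow> gamma_seminorm \<mu> m k \<psi> < r" for \<psi>
  proof -
    have "\<psi> \<in> U" using FU that by blast
    then show ?thesis by (simp add: U_def)
  qed
  \<comment> \<open>The sum of the orders stands in for their maximum; all that matters is that it
    dominates each of them.\<close>
  define N where "N = (\<Sum>(m, k)\<in>F. mi_abs k)"
  have N: "mi_abs k \<le> N" if "(m, k) \<in> F" for m k
    using member_le_sum[OF that, of "\<lambda>(m, k). mi_abs k"] F by (simp add: N_def)
  have "f \<phi> = 0" if phi: "\<phi> \<in> H_space \<mu>" and T0: "\<And>k. mi_abs k \<le> N \<Longrightarrow> T_delta \<mu> k \<phi> = 0" for \<phi>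
  proof (rule ccontr)
    assume neq: "f \<phi> \<noteq> 0"
    have lim: "(T_word w (weighted \<mu> \<phi>) \<longlongrightarrow> 0) (at 0 within orthant)" if "length w \<le> N" for w
      by (rule T_delta_eq_0_imp_tendsto[OF mu phi T0 that])
    have "\<exists>C\<ge>0. (m, k) \<in> F \<longrightarrow> (\<forall>d x. 0 < d \<longrightarrow> d \<le> 1 \<longrightarrow> x \<in> orthant \<longrightarrow>
        gamma_fun \<mu> m k (\<lambda>x. ball_cutoff 0 d x * \<phi> x) x \<le> C * d)" for m k
    proof (cases "(m, k) \<in> F")
      case True
      then have len: "length (mi_word k) \<le> N" using N by (simp add: length_mi_word)
      show ?thesis unfolding gamma_fun_eq using ball_cutoff_mult_small[OF phi lim len, of m] by blast
    qed auto
    then obtain C where C0: "\<And>m k. 0 \<le> C m k" and C: "\<And>m k d x. (m, k) \<in> F \<Longrightarrow> 0 < d \<Longrightarrow> d \<le> 1 \<Longrightarrow>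
        x \<in> orthant \<Longrightarrow> gamma_fun \<mu> m k (\<lambda>x. ball_cutoff 0 d x * \<phi> x) x \<le> C m k * d"
      by metis
    \<comment> \<open>\<open>D * d\<close> will bound every relevant seminorm of the localised
      function divided by \<open>f \<phi>\<close>. The summand 1 keeps \<open>D\<close> positive
      even if all constants vanish, and \<open>d\<close> is then taken small enough that
      \<open>D * d \<le> r / 2\<close>.\<close>
    define D where "D = ((\<Sum>(m, k)\<in>F. C m k) + 1) / norm (f \<phi>)"
    have "(\<Sum>(m, k)\<in>F. C m k) \<ge> 0" by (rule sum_nonneg) (auto simp: C0)
    then have D: "D > 0" unfolding D_def using neq by simp
    define d where "d = min 1 (r / (2 * D))"
    have d: "0 < d" "d \<le> 1" using D r by (auto simp: d_def)
    have "D * d \<le> D * (r / (2 * D))" using D by (intro mult_left_mono) (auto simp: d_def)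
    also have "\<dots> < r" using D r by simp
    finally have Dd: "D * d < r" .
    let ?\<psi> = "\<lambda>x. ball_cutoff 0 d x * \<phi> x"
    have psi: "?\<psi> \<in> H_space \<mu>" by (rule H_space_ball_cutoff[OF phi d(1)])
    have rest: "(\<lambda>x. \<phi> x + - 1 * ?\<psi> x) \<in> H_space \<mu>"
      by (intro H_space_add phi H_space_cmult[OF psi])
    \<comment> \<open>The cutoff equals 1 for \<open>||x||^2 \<le> d/2\<close>, which gives the
      radius \<open>sqrt (d / 2)\<close>.\<close>
    have "supp (\<lambda>x. \<phi> x + - 1 * ?\<psi> x) \<subseteq> {x \<in> orthant. sqrt (d / 2) \<le> norm x}"
    proof -
      have "{x \<in> orthant. \<phi> x + - 1 * ?\<psi> x \<noteq> 0} \<subseteq> {x. sqrt (d / 2) \<le> norm x}"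
      proof
        fix x assume "x \<in> {x \<in> orthant. \<phi> x + - 1 * ?\<psi> x \<noteq> 0}"
        then have "ball_cutoff 0 d x \<noteq> 1" by auto
        then have "d / 2 \<le> (norm x)\<^sup>2" using ball_cutoff_eq_1[OF d(1), of x] by linarith
        then show "x \<in> {x. sqrt (d / 2) \<le> norm x}" by (simp add: real_le_lsqrt)
      qed
      moreover have "closed {x :: (real, 'n) vec. sqrt (d / 2) \<le> norm x}"
        by (intro closed_Collect_le continuous_intros)
      ultimately have "closure {x \<in> orthant. \<phi> x + - 1 * ?\<psi> x \<noteq> 0} \<subseteq> {x. sqrt (d / 2) \<le> norm x}"
        by (rule closure_minimal)
      then show ?thesis unfolding supp_def by blast
    qed
    moreover have "sqrt (d / 2) > 0" using d by simp
    ultimately have "f (\<lambda>x. \<phi> x + - 1 * ?\<psi> x) = 0" using bspec[OF supp rest] by blast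
    then have eq: "f ?\<psi> = f \<phi>"
      using f_add[OF phi H_space_cmult[OF psi, of "- 1"]] f_scale[OF psi, of "- 1"] by simp
    \<comment> \<open>The neighbourhood only yields values of modulus below 1. Dividing by
      \<open>f \<phi>\<close> makes the value exactly 1, so its smallness is a
      contradiction.\<close>
    have "norm (f (\<lambda>x. inverse (f \<phi>) * ?\<psi> x)) < 1"
    proof (rule nhd[OF H_space_cmult[OF psi]])
      fix m k assume mk: "(m, k) \<in> F"
      have "C m k \<le> (\<Sum>(m, k)\<in>F. C m k)"
        using member_le_sum[OF mk, of "\<lambda>(m, k). C m k"] C0 F by auto
      then have "C m k / norm (f \<phi>) \<le> D"
        unfolding D_def by (intro divide_right_mono) auto
      then have CD: "C m k / norm (f \<phi>) * d \<le> D * d" using d by (intro mult_right_mono) auto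
      have "gamma_seminorm \<mu> m k (\<lambda>x. inverse (f \<phi>) * ?\<psi> x) \<le> C m k / norm (f \<phi>) * d"
      proof (rule gamma_seminorm_le)
        fix x :: "(real, 'n) vec" assume x: "x \<in> orthant"
        have "gamma_fun \<mu> m k (\<lambda>x. inverse (f \<phi>) * ?\<psi> x) x = inverse (norm (f \<phi>)) * gamma_fun \<mu> m k ?\<psi> x"
          using x H_space_weighted_smooth[OF psi]
          by (simp add: gamma_fun_eq weighted_mult[of \<mu> "\<lambda>_. inverse (f \<phi>)"] T_word_cmult norm_mult norm_inverse)
        also have "\<dots> \<le> inverse (norm (f \<phi>)) * (C m k * d)"
          using C[OF mk d x] by (intro mult_left_mono) auto
        finally show "gamma_fun \<mu> m k (\<lambda>x. inverse (f \<phi>) * ?\<psi> x) x \<le> C m k / norm (f \<phi>) * d"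
          by (simp add: field_simps)
      qed
      then show "gamma_seminorm \<mu> m k (\<lambda>x. inverse (f \<phi>) * ?\<psi> x) < r" using CD Dd by linarith
    qed
    then show False using f_scale[OF psi, of "inverse (f \<phi>)"] eq neq by simp
  qed
  then show ?thesis using that by blast
qed

theorem theorem5p1:
  fixes \<mu> :: "real ^ 'n::{finite,linorder}"
    and f :: "(real ^ 'n::{finite,linorder} \<Rightarrow> complex) \<Rightarrow> complex"
  assumes "\<forall>i. - 1/2 \<le> \<mu> $ i"
    and "f \<in> H_dual \<mu>"
    and "\<forall>\<phi>\<in>H_space \<mu>. (\<exists>a>0. supp \<phi> \<subseteq> {x \<in> orthant. a \<le> norm x}) \<longrightarrow> f \<phi> = 0"
  shows "\<exists>(N :: nat) (c :: nat ^ 'n::{finite,linorder} \<Rightarrow> complex).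
           \<forall>\<phi>\<in>H_space \<mu>. f \<phi> = (\<Sum>k\<in>{k. mi_abs k \<le> N}. c k * T_delta \<mu> k \<phi>)"
proof -
  obtain N where N: "\<And>\<phi>. \<phi> \<in> H_space \<mu> \<Longrightarrow> (\<And>k. mi_abs k \<le> N \<Longrightarrow> T_delta \<mu> k \<phi> = 0) \<Longrightarrow> f \<phi> = 0"
    using H_dual_eq_0_of_T_delta_eq_0[OF assms] by blast
  \<comment> \<open>Since \<open>N\<close> does not depend on \<phi>, the common kernel is that of
    one finite family, and the linear algebra applies.\<close>
  have "\<exists>c. \<forall>\<phi>\<in>H_space \<mu>. f \<phi> = (\<Sum>k\<in>{k. mi_abs k \<le> N}. c k * T_delta \<mu> k \<phi>)"
    using assms(2) N
    by (intro linear_functional_in_span finite_mi_abs_le H_space_add H_space_cmult T_delta_add T_delta_cmult)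
      (auto simp: H_dual_def)
  then show ?thesis by blast
qed

end
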